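(* Let $W$ be the Weyl group of type $A_n$ and let $u,v,w\in W$ be boolean elements. The following algorithm returns a (non-equivariant) boolean insertion path $u\xrightarrow{\supp(v)}w$ if one exists, and otherwise returns $\mathbf{None}$; its running time is $O(n^2)$. Algorithm. (1) Initialize $B=B(u)$, $P$ an empty list, and $S=\supp(v)$. (2) Check whether $B(u)\subseteq B(w)$; if not, return $\mathbf{None}$. (3) For each $i\in S$ in increasing order, try the boolean insertion $B\xrightarrow{i}$: if there is only one possible insertion step $B\xrightarrow{i}B'$ satisfying $B'\subseteq B(w)$, remove $i$ from $S$, append this step to $P$ and replace $B$ by $B'$; if no such $B'\subseteq B(w)$ exists, return $\mathbf{None}$. (4) Repeat step (3) until no such insertions are available. (5) Let the remaining elements of $S$ be $i_1<\dots<i_m$ and the vertices of $B(w)$ not in $B$ be $j_1<\dots<j_m$. For $k=1,\dots,m$ in increasing order, perform $B\xrightarrow{i_k}B'$ such that the newly added vertex of $B'$ is exactly $j_k$ and $B'\subseteq B(w)$, replacing $B$ by $B'$; append these insertions to $P$ if they exist, and return $\mathbf{None}$ if not. (6) Return $P$.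
   Context: $W$ is the symmetric group $S_{n+1}$ with simple roots $\Delta=\{\alpha_1,\dots,\alpha_n\}$ (identified with indices $1,\dots,n$), simple reflections $s_i$, and Coxeter length $\ell$. $\supp(w)$ is the set of $i$ such that $s_i$ appears in some (equivalently every) reduced word of $w$; $w$ is boolean if $\ell(w)=|\supp(w)|$. Indices $i,j$ are adjacent iff $|i-j|=1$. Boolean diagram: for boolean $w$, $B(w)$ is the directed graph on $\supp(w)$ with an arrow $k\to j$ whenever $|j-k|=1$ and $s_j$ appears before $s_k$ in the reduced words of $w$; boolean elements are determined by their boolean diagrams, and the algorithm manipulates boolean elements through their diagrams. $B(u)\subseteq B(w)$ means $\supp(u)\subseteq\supp(w)$ and each arrow of $B(u)$ is an arrow of $B(w)$. Non-equivariant boolean insertion: for boolean $u,v$ and $i\in\{1,\dots,n\}$, $u\xrightarrow{i}v$ holds if either (1) $i\in\supp(u)$, $\ell(v)=\ell(u)+1$, $B(u)\subseteq B(v)$, and there is a directed path in $B(v)$ from $i$ to the unique vertex of $\supp(v)\setminus\supp(u)$ (the newly added vertex); or (3) $i\notin\supp(u)$, $\ell(v)=\ell(u)+1$, $B(u)\subseteq B(v)$ and $\supp(v)\setminus\supp(u)=\{i\}$. A boolean insertion path $u\xrightarrow{\supp(v)}w$ is a sequence $u=u^{(0)}\xrightarrow{\beta_1}u^{(1)}\cdots\xrightarrow{\beta_m}u^{(m)}=w$ of such insertions, where $(\beta_1,\dots,\beta_m)$ is some ordering of $\supp(v)$ (the algorithm chooses the ordering). *)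

theory Defs
  imports "HOL-Combinatorics.Permutations" "HOL-Library.Landau_Symbols"
    "HOL-Library.Monad_Syntax"
begin

section \<open>Boolean elements of the symmetric group and their diagrams\<close>

definition weyl_A :: "nat \<Rightarrow> (nat \<Rightarrow> nat) set" where
  "weyl_A n = {w. w permutes {1..Suc n}}"

definition simple_reflection :: "nat \<Rightarrow> nat \<Rightarrow> nat" where
  "simple_reflection i = transpose i (Suc i)"

definition word_prod :: "nat list \<Rightarrow> nat \<Rightarrow> nat" where
  "word_prod ws = foldr (\<lambda>i f. simple_reflection i \<circ> f) ws id"

definition is_word :: "nat \<Rightarrow> (nat \<Rightarrow> nat) \<Rightarrow> nat list \<Rightarrow> bool" where
  "is_word n w ws \<longleftrightarrow> set ws \<subseteq> {1..n} \<and> word_prod ws = w"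

definition coxeter_length :: "nat \<Rightarrow> (nat \<Rightarrow> nat) \<Rightarrow> nat" where
  "coxeter_length n w = (LEAST k. \<exists>ws. is_word n w ws \<and> length ws = k)"

definition reduced_word :: "nat \<Rightarrow> (nat \<Rightarrow> nat) \<Rightarrow> nat list \<Rightarrow> bool" where
  "reduced_word n w ws \<longleftrightarrow> is_word n w ws \<and> length ws = coxeter_length n w"

definition supp :: "nat \<Rightarrow> (nat \<Rightarrow> nat) \<Rightarrow> nat set" where
  "supp n w = {i. \<exists>ws. reduced_word n w ws \<and> i \<in> set ws}"

definition boolean :: "nat \<Rightarrow> (nat \<Rightarrow> nat) \<Rightarrow> bool" where
  "boolean n w \<longleftrightarrow> w \<in> weyl_A n \<and> coxeter_length n w = card (supp n w)"

definition adjacent :: "nat \<Rightarrow> nat \<Rightarrow> bool" where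
  "adjacent i j \<longleftrightarrow> j = Suc i \<or> i = Suc j"

definition appears_before :: "nat \<Rightarrow> nat \<Rightarrow> nat list \<Rightarrow> bool" where
  "appears_before j k ws \<longleftrightarrow> (\<exists>p q. p < q \<and> q < length ws \<and> ws ! p = j \<and> ws ! q = k)"

text \<open>A directed graph is a pair of a vertex set and an arrow set; the pair \<open>(k, j)\<close> is the
  arrow from \<open>k\<close> to \<open>j\<close>.\<close>

type_synonym diagram = "nat set \<times> (nat \<times> nat) set"

abbreviation vertices :: "diagram \<Rightarrow> nat set" where "vertices \<equiv> fst"
abbreviation arrows :: "diagram \<Rightarrow> (nat \<times> nat) set" where "arrows \<equiv> snd"

definition boolean_diagram :: "nat \<Rightarrow> (nat \<Rightarrow> nat) \<Rightarrow> diagram" where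
  "boolean_diagram n w =
     (supp n w,
      {(k, j). k \<in> supp n w \<and> j \<in> supp n w \<and> adjacent j k \<and>
               (\<forall>ws. reduced_word n w ws \<longrightarrow> appears_before j k ws)})"

definition subdiagram :: "diagram \<Rightarrow> diagram \<Rightarrow> bool" where
  "subdiagram B C \<longleftrightarrow> vertices B \<subseteq> vertices C \<and> arrows B \<subseteq> arrows C"

section \<open>Boolean insertion\<close>

definition boolean_insertion ::
  "nat \<Rightarrow> (nat \<Rightarrow> nat) \<Rightarrow> nat \<Rightarrow> (nat \<Rightarrow> nat) \<Rightarrow> bool" where
  "boolean_insertion n u i v \<longleftrightarrow>
     boolean n u \<and> boolean n v \<and> i \<in> {1..n} \<and>
     coxeter_length n v = coxeter_length n u + 1 \<and>
     subdiagram (boolean_diagram n u) (boolean_diagram n v) \<and>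
     ((i \<in> supp n u \<and>
        (\<exists>j. supp n v - supp n u = {j} \<and> (i, j) \<in> (arrows (boolean_diagram n v))\<^sup>*)) \<or>
      (i \<notin> supp n u \<and> supp n v - supp n u = {i}))"

definition boolean_insertion_path ::
  "nat \<Rightarrow> (nat \<Rightarrow> nat) \<Rightarrow> (nat \<Rightarrow> nat) \<Rightarrow> (nat \<Rightarrow> nat) \<Rightarrow> (nat \<Rightarrow> nat) list \<Rightarrow> nat list \<Rightarrow> bool"
where
  "boolean_insertion_path n u v w us bs \<longleftrightarrow>
     distinct bs \<and> set bs = supp n v \<and>
     length us = Suc (length bs) \<and> us ! 0 = u \<and> us ! length bs = w \<and>
     (\<forall>k < length bs. boolean_insertion n (us ! k) (bs ! k) (us ! Suc k))"

type_synonym step = "diagram \<times> nat \<times> diagram"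

definition path_steps :: "nat \<Rightarrow> (nat \<Rightarrow> nat) list \<Rightarrow> nat list \<Rightarrow> step list" where
  "path_steps n us bs =
     map (\<lambda>k. (boolean_diagram n (us ! k), bs ! k, boolean_diagram n (us ! Suc k)))
         [0..<length bs]"

section \<open>The algorithm\<close>

definition diagram_insertion :: "nat \<Rightarrow> diagram \<Rightarrow> nat \<Rightarrow> diagram \<Rightarrow> bool" where
  "diagram_insertion n B i B' \<longleftrightarrow>
     (\<exists>x y. boolean_insertion n x i y \<and> B = boolean_diagram n x \<and> B' = boolean_diagram n y)"

definition insertions_below :: "nat \<Rightarrow> diagram \<Rightarrow> diagram \<Rightarrow> nat \<Rightarrow> diagram set" where
  "insertions_below n W B i = {B'. diagram_insertion n B i B' \<and> subdiagram B' W}"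

text \<open>One traversal of the increasing list of the current elements of \<open>S\<close> (step 3). The result
  holds the new \<open>B\<close>, the new \<open>P\<close> and the elements left in \<open>S\<close>. Elements with several possible
  insertions stay in \<open>S\<close>.\<close>

fun forced_pass ::
  "nat \<Rightarrow> diagram \<Rightarrow> diagram \<Rightarrow> step list \<Rightarrow> nat list \<Rightarrow> (diagram \<times> step list \<times> nat list) option"
where
  "forced_pass n W B P [] = Some (B, P, [])"
| "forced_pass n W B P (i # S) =
     (if insertions_below n W B i = {} then None
      else if \<exists>!B'. B' \<in> insertions_below n W B i then
        (let B' = the_elem (insertions_below n W B i)
         in forced_pass n W B' (P @ [(B, i, B')]) S)
      else
        (case forced_pass n W B P S of
           None \<Rightarrow> None
         | Some (B', P', S') \<Rightarrow> Some (B', P', i # S')))"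

text \<open>Step 4. A traversal performs an insertion exactly if it shortens the list.\<close>

function forced_passes ::
  "nat \<Rightarrow> diagram \<Rightarrow> diagram \<Rightarrow> step list \<Rightarrow> nat list \<Rightarrow> (diagram \<times> step list \<times> nat list) option"
where
  "forced_passes n W B P S =
     (case forced_pass n W B P S of
        None \<Rightarrow> None
      | Some (B', P', S') \<Rightarrow>
          if length S' < length S then forced_passes n W B' P' S' else Some (B', P', S'))"
  by pat_completeness auto
termination by (relation "measure (\<lambda>(n, W, B, P, S). length S)") auto

text \<open>Step 5. If \<open>S\<close> and the set of missing vertices have different sizes, some prescribed
  insertion does not exist or the target is not reached, and the result is \<^const>\<open>None\<close>.\<close>

fun matched_insertions ::
  "nat \<Rightarrow> diagram \<Rightarrow> diagram \<Rightarrow> step list \<Rightarrow> nat list \<Rightarrow> nat list \<Rightarrow> step list option"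
where
  "matched_insertions n W B P [] [] = Some P"
| "matched_insertions n W B P (i # I) (j # J) =
     (if \<exists>B' \<in> insertions_below n W B i. vertices B' - vertices B = {j} then
        (let B' = (THE B'. B' \<in> insertions_below n W B i \<and> vertices B' - vertices B = {j})
         in matched_insertions n W B' (P @ [(B, i, B')]) I J)
      else None)"
| "matched_insertions n W B P _ _ = None"

definition insertion_algorithm :: "nat \<Rightarrow> diagram \<Rightarrow> diagram \<Rightarrow> diagram \<Rightarrow> step list option" where
  "insertion_algorithm n U V W =
     (if subdiagram U W then
        (case forced_passes n W U [] (sorted_list_of_set (vertices V)) of
           None \<Rightarrow> None
         | Some (B, P, S) \<Rightarrow>
             matched_insertions n W B P S (sorted_list_of_set (vertices W - vertices B)))
      else None)"

section \<open>Counting the elementary operations\<close>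

text \<open>\<open>TM x t\<close> is a computation with result \<open>x\<close> that performs \<open>t\<close> elementary operations.\<close>

datatype 'a tm = TM (val: 'a) (time: nat)

fun bind_tm :: "'a tm \<Rightarrow> ('a \<Rightarrow> 'b tm) \<Rightarrow> 'b tm" where
  "bind_tm m f = TM (val (f (val m))) (time m + time (f (val m)))"

adhoc_overloading Monad_Syntax.bind \<rightleftharpoons> bind_tm

lemma bind_tm_cong [fundef_cong]:
  "m = m' \<Longrightarrow> (\<And>x. x = val m' \<Longrightarrow> f x = g x) \<Longrightarrow> bind_tm m f = bind_tm m' g"
  by simp

definition return :: "'a \<Rightarrow> 'a tm" where
  "return x = TM x 0"

definition tick :: "nat \<Rightarrow> unit tm" where
  "tick t = TM () t"

text \<open>The machine model is the unit-cost RAM. A diagram with vertices in \<open>{1..n}\<close> is stored as a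
  mutable bit array for its vertices and two for its arrows \<open>k \<rightarrow> k + 1\<close> and \<open>k + 1 \<rightarrow> k\<close>: reading
  or writing one bit costs 1, and a copy (needed to record a diagram that is modified later) costs
  \<open>3 * n\<close>. Every call of a procedure below, recursive calls included, is charged 1; this pays for
  the bounded number of index operations, comparisons and list cells handled in its body. Operations on whole lists
  are charged their length.\<close>

definition has_vertex :: "diagram \<Rightarrow> nat \<Rightarrow> bool tm" where
  "has_vertex B k = TM (k \<in> vertices B) 1"

definition has_arrow :: "diagram \<Rightarrow> nat \<Rightarrow> nat \<Rightarrow> bool tm" where
  "has_arrow B k j = TM ((k, j) \<in> arrows B) 1"

definition add_vertex :: "nat \<Rightarrow> diagram \<Rightarrow> diagram tm" where
  "add_vertex k B = TM (insert k (vertices B), arrows B) 1"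

definition add_arrow :: "nat \<Rightarrow> nat \<Rightarrow> diagram \<Rightarrow> diagram tm" where
  "add_arrow k j B = TM (vertices B, insert (k, j) (arrows B)) 1"

definition copy_diagram :: "nat \<Rightarrow> diagram \<Rightarrow> diagram tm" where
  "copy_diagram n B = TM B (3 * n)"

definition length_tm :: "'a list \<Rightarrow> nat tm" where
  "length_tm xs = TM (length xs) (length xs + 1)"

definition member_tm :: "'a \<Rightarrow> 'a list \<Rightarrow> bool tm" where
  "member_tm x xs = TM (x \<in> set xs) (length xs + 1)"

definition rev_tm :: "'a list \<Rightarrow> 'a list tm" where
  "rev_tm xs = TM (rev xs) (length xs + 1)"

fun subdiagram_tm :: "nat \<Rightarrow> diagram \<Rightarrow> diagram \<Rightarrow> bool tm" where
  "subdiagram_tm 0 B C = do { tick 1; return True }"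
| "subdiagram_tm (Suc k) B C = do {
     tick 1;
     b \<leftarrow> has_vertex B (Suc k);
     c \<leftarrow> has_vertex C (Suc k);
     bu \<leftarrow> has_arrow B (Suc k) (Suc (Suc k));
     cu \<leftarrow> has_arrow C (Suc k) (Suc (Suc k));
     bd \<leftarrow> has_arrow B (Suc (Suc k)) (Suc k);
     cd \<leftarrow> has_arrow C (Suc (Suc k)) (Suc k);
     if (b \<longrightarrow> c) \<and> (bu \<longrightarrow> cu) \<and> (bd \<longrightarrow> cd) then subdiagram_tm k B C else return False
   }"

fun vertex_list_tm :: "nat \<Rightarrow> diagram \<Rightarrow> nat list \<Rightarrow> nat list tm" where
  "vertex_list_tm 0 V acc = do { tick 1; return acc }"
| "vertex_list_tm (Suc k) V acc = do {
     tick 1;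
     b \<leftarrow> has_vertex V (Suc k);
     vertex_list_tm k V (if b then Suc k # acc else acc)
   }"

fun missing_list_tm :: "nat \<Rightarrow> diagram \<Rightarrow> diagram \<Rightarrow> nat list \<Rightarrow> nat list tm" where
  "missing_list_tm 0 W B acc = do { tick 1; return acc }"
| "missing_list_tm (Suc k) W B acc = do {
     tick 1;
     b \<leftarrow> has_vertex W (Suc k);
     c \<leftarrow> has_vertex B (Suc k);
     missing_list_tm k W B (if b \<and> \<not> c then Suc k # acc else acc)
   }"

text \<open>Follow the arrows of \<open>W\<close> upwards (downwards) from a vertex of \<open>B\<close>, through vertices of \<open>B\<close>,
  until a vertex outside \<open>B\<close> is reached or the arrows stop.\<close>

function scan_up_tm :: "nat \<Rightarrow> diagram \<Rightarrow> diagram \<Rightarrow> nat \<Rightarrow> nat list tm" where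
  "scan_up_tm n W B k = do {
     tick 1;
     if n \<le> k then return []
     else do {
       a \<leftarrow> has_arrow W k (Suc k);
       if \<not> a then return []
       else do {
         b \<leftarrow> has_vertex B (Suc k);
         if b then scan_up_tm n W B (Suc k) else return [Suc k]
       }
     }
   }"
  by pat_completeness auto
termination by (relation "measure (\<lambda>(n, W, B, k). n - k)") auto

fun scan_down_tm :: "diagram \<Rightarrow> diagram \<Rightarrow> nat \<Rightarrow> nat list tm" where
  "scan_down_tm W B 0 = do { tick 1; return [] }"
| "scan_down_tm W B (Suc k) = do {
     tick 1;
     a \<leftarrow> has_arrow W (Suc k) k;
     if \<not> a then return []
     else do {
       b \<leftarrow> has_vertex B k;
       if b then scan_down_tm W B k else return [k]
     }
   }"

text \<open>The vertices, at most two, that an insertion \<open>B \<rightarrow> B'\<close> at \<open>i\<close> with \<open>B'\<close> below \<open>W\<close> can add.\<close>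

definition targets_tm :: "nat \<Rightarrow> diagram \<Rightarrow> diagram \<Rightarrow> nat \<Rightarrow> nat list tm" where
  "targets_tm n W B i = do {
     tick 1;
     b \<leftarrow> has_vertex B i;
     if b then do {
       down \<leftarrow> scan_down_tm W B i;
       up \<leftarrow> scan_up_tm n W B i;
       return (down @ up)
     }
     else do {
       c \<leftarrow> has_vertex W i;
       return (if c then [i] else [])
     }
   }"

definition link_tm :: "diagram \<Rightarrow> nat \<Rightarrow> nat \<Rightarrow> diagram \<Rightarrow> diagram tm" where
  "link_tm W j k B = do {
     tick 1;
     b \<leftarrow> has_vertex B k;
     if \<not> b then return B
     else do {
       a \<leftarrow> has_arrow W j k;
       if a then add_arrow j k B else add_arrow k j B
     }
   }"

definition perform_tm ::
  "nat \<Rightarrow> diagram \<Rightarrow> diagram \<Rightarrow> nat \<Rightarrow> nat \<Rightarrow> step list \<Rightarrow> (diagram \<times> step list) tm" where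
  "perform_tm n W B i j P = do {
     tick 1;
     old \<leftarrow> copy_diagram n B;
     B1 \<leftarrow> add_vertex j B;
     B2 \<leftarrow> link_tm W j (j - 1) B1;
     B' \<leftarrow> link_tm W j (j + 1) B2;
     new \<leftarrow> copy_diagram n B';
     return (B', (old, i, new) # P)
   }"

text \<open>In the procedures below the list \<open>P\<close> is kept in reverse order.\<close>

fun forced_pass_tm ::
  "nat \<Rightarrow> diagram \<Rightarrow> diagram \<Rightarrow> step list \<Rightarrow> nat list \<Rightarrow> (diagram \<times> step list \<times> nat list) option tm"
where
  "forced_pass_tm n W B P [] = do { tick 1; return (Some (B, P, [])) }"
| "forced_pass_tm n W B P (i # S) = do {
     tick 1;
     js \<leftarrow> targets_tm n W B i;
     case js of
       [] \<Rightarrow> return None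
     | [j] \<Rightarrow> do {
         BP \<leftarrow> perform_tm n W B i j P;
         forced_pass_tm n W (fst BP) (snd BP) S
       }
     | _ \<Rightarrow> do {
         r \<leftarrow> forced_pass_tm n W B P S;
         return (case r of None \<Rightarrow> None | Some (B', P', S') \<Rightarrow> Some (B', P', i # S'))
       }
   }"

function forced_passes_tm ::
  "nat \<Rightarrow> diagram \<Rightarrow> diagram \<Rightarrow> step list \<Rightarrow> nat list \<Rightarrow> (diagram \<times> step list \<times> nat list) option tm"
where
  "forced_passes_tm n W B P S = do {
     tick 1;
     r \<leftarrow> forced_pass_tm n W B P S;
     case r of
       None \<Rightarrow> return None
     | Some (B', P', S') \<Rightarrow> do {
         l' \<leftarrow> length_tm S';
         l \<leftarrow> length_tm S;
         if l' < l then forced_passes_tm n W B' P' S' else return (Some (B', P', S'))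
       }
   }"
  by pat_completeness auto
termination
  by (relation "measure (\<lambda>(n, W, B, P, S). length S)") (auto simp: length_tm_def)

fun matched_insertions_tm ::
  "nat \<Rightarrow> diagram \<Rightarrow> diagram \<Rightarrow> step list \<Rightarrow> nat list \<Rightarrow> nat list \<Rightarrow> step list option tm"
where
  "matched_insertions_tm n W B P [] [] = do { tick 1; Q \<leftarrow> rev_tm P; return (Some Q) }"
| "matched_insertions_tm n W B P (i # I) (j # J) = do {
     tick 1;
     js \<leftarrow> targets_tm n W B i;
     b \<leftarrow> member_tm j js;
     if b then do {
       BP \<leftarrow> perform_tm n W B i j P;
       matched_insertions_tm n W (fst BP) (snd BP) I J
     }
     else return None
   }"
| "matched_insertions_tm n W B P _ _ = do { tick 1; return None }"

definition insertion_algorithm_tm ::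
  "nat \<Rightarrow> diagram \<Rightarrow> diagram \<Rightarrow> diagram \<Rightarrow> step list option tm" where
  "insertion_algorithm_tm n U V W = do {
     tick 1;
     B \<leftarrow> copy_diagram n U;
     S \<leftarrow> vertex_list_tm n V [];
     ok \<leftarrow> subdiagram_tm n U W;
     if \<not> ok then return None
     else do {
       r \<leftarrow> forced_passes_tm n W B [] S;
       case r of
         None \<Rightarrow> return None
       | Some (B', P, S') \<Rightarrow> do {
           J \<leftarrow> missing_list_tm n W B' [];
           matched_insertions_tm n W B' P S' J
         }
     }
   }"

definition worst_case_time :: "nat \<Rightarrow> nat" where
  "worst_case_time n =
     Max {time (insertion_algorithm_tm n
            (boolean_diagram n u) (boolean_diagram n v) (boolean_diagram n w)) |
          u v w. boolean n u \<and> boolean n v \<and> boolean n w}"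

end

theory Submission
  imports Defs
begin

text \<open>Boolean elements are the products of words without repeated letters, and the diagrams below
  \<open>B(w)\<close> are its induced subdiagrams, so the current diagram is a set \<open>X\<close> of vertices of \<open>B(w)\<close>. An
  insertion at \<open>i\<close> adds a missing vertex at the end of a directed path that starts in \<open>i\<close> and runs
  through \<open>X\<close>. An index without a target never regains one, and by an exchange argument a forced
  insertion can always be performed first. When no insertion is forced, every remaining index is a
  source of \<open>B(w)\<close> with a missing vertex on either side; hence more vertices are missing than
  indices are left, no path exists, and step (5) fails as well. Paths from different sources are
  disjoint, so that all indices kept in a traversal are scanned in time \<open>O(n)\<close> together, while each
  forced insertion costs \<open>O(n)\<close> once.\<close>

section \<open>Words and diagrams of boolean elements\<close>

text \<open>Length, support and diagram are defined through all reduced words, so the first task is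
  to read them off the permutation. Two invariants do this: s_i occurs in the reduced words of w
  exactly when w does not preserve \<open>{..i}\<close>, and in a product of distinct letters
  s_(i+1) stands before s_i exactly when some x \<le> i is sent above i + 1. A path may use the
  indices of supp(v) in any order, whereas the algorithm follows one order. Hence
  \<open>completable\<close> remembers only the present vertices and the remaining indices, and the
  exchange argument becomes an induction over it. For the running time, up to n + 1 traversals may
  each visit up to n indices, so a linear cost per visit would only give a cubic bound. The kept
  indices of one traversal have to share a linear budget.\<close>

lemma word_prod_Nil [simp]: "word_prod [] = id"
  by (simp add: word_prod_def)

lemma word_prod_Cons [simp]: "word_prod (i # ws) = simple_reflection i \<circ> word_prod ws"
  by (simp add: word_prod_def)

lemma word_prod_append [simp]: "word_prod (xs @ ys) = word_prod xs \<circ> word_prod ys"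
  by (induction xs) (auto simp: comp_assoc)

lemma simple_reflection_apply:
  "simple_reflection i x = (if x = i then Suc i else if x = Suc i then i else x)"
  by (simp add: simple_reflection_def transpose_def)

lemma bij_word_prod: "bij (word_prod ws)"
  by (induction ws) (simp_all only: word_prod_Nil word_prod_Cons simple_reflection_def
      bij_id bij_comp bij_transpose)

lemma word_prod_eq_iff [simp]: "word_prod ws x = word_prod ws y \<longleftrightarrow> x = y"
  using bij_word_prod by (simp add: bij_is_inj inj_eq)

text \<open>For w in \<open>weyl_A n\<close> this is membership in the parabolic subgroup generated
  by the s_j with j \<noteq> i. The support consists of the i at which it fails.\<close>

definition keeps :: "nat \<Rightarrow> (nat \<Rightarrow> nat) \<Rightarrow> bool" where
  "keeps i f \<longleftrightarrow> (\<forall>x. f x \<le> i \<longleftrightarrow> x \<le> i)"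

lemma keeps_word_prod: "i \<notin> set ws \<Longrightarrow> keeps i (word_prod ws)"
proof (induction ws)
  case (Cons j ws)
  then have "simple_reflection j y \<le> i \<longleftrightarrow> y \<le> i" for y
    by (auto simp: simple_reflection_apply)
  with Cons show ?case by (simp add: keeps_def)
qed (simp add: keeps_def)

text \<open>Only the single letter \<open>i\<close> moves strands across the boundary between i and
  i + 1; it lifts the strand that arrives at i, and nothing brings that strand back.\<close>

lemma not_keeps_distinct:
  assumes "distinct ws" "i \<in> set ws"
  shows "\<not> keeps i (word_prod ws)"
proof
  assume k: "keeps i (word_prod ws)"
  obtain a b where ws: "ws = a @ i # b" using assms split_list by fast
  have "i \<notin> set a" "i \<notin> set b" using assms ws by auto
  then have ka: "keeps i (word_prod a)" and kb: "keeps i (word_prod b)"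
    by (auto intro: keeps_word_prod)
  obtain x where x: "word_prod b x = i"
    using bij_word_prod[of b] by (metis bij_pointE)
  have "word_prod ws x = word_prod a (Suc i)"
    by (simp add: ws x simple_reflection_apply)
  then have "\<not> word_prod ws x \<le> i" using ka by (simp add: keeps_def)
  moreover have "x \<le> i" using kb x by (metis keeps_def order_refl)
  ultimately show False using k by (simp add: keeps_def)
qed

lemma keeps_distinct_iff: "distinct ws \<Longrightarrow> keeps i (word_prod ws) \<longleftrightarrow> i \<notin> set ws"
  using keeps_word_prod not_keeps_distinct by blast

text \<open>Letters act from right to left and each swaps two neighbouring values, so two strands
  change their order only at a letter \<open>j\<close> that meets them on \<open>j\<close> and
  \<open>Suc j\<close>.\<close>

lemma order_reversal_split:
  assumes "word_prod c x < word_prod c y" "y < x"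
  shows "\<exists>c1 j c2. c = c1 @ j # c2 \<and> word_prod c2 x = Suc j \<and> word_prod c2 y = j"
  using assms
proof (induction c)
  case (Cons j c)
  show ?case
  proof (cases "word_prod c x < word_prod c y")
    case True
    then obtain c1 j' c2 where "c = c1 @ j' # c2 \<and> word_prod c2 x = Suc j' \<and> word_prod c2 y = j'"
      using Cons by blast
    then show ?thesis by (metis append_Cons)
  next
    case False
    moreover have "word_prod c x \<noteq> word_prod c y" using Cons.prems by simp
    ultimately have "word_prod c x = Suc j \<and> word_prod c y = j"
      using Cons.prems by (auto simp: simple_reflection_apply split: if_splits)
    then show ?thesis by blast
  qed
qed auto

text \<open>The first occurrence of \<open>s\<^sub>i\<close> from the right makes a strand from \<open>{..i}\<close> cross a strand from
  \<open>{i<..}\<close>. These two strands have to cross back, and both crossings can be deleted.\<close>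

lemma shorter_word:
  assumes "keeps i (word_prod ws)" "i \<in> set ws"
  shows "\<exists>ws'. set ws' \<subseteq> set ws \<and> length ws' < length ws \<and> word_prod ws' = word_prod ws"
proof -
  obtain c b where ws: "ws = c @ i # b" and ib: "i \<notin> set b"
    using assms(2) split_list_last by fast
  have kb: "keeps i (word_prod b)" using ib by (rule keeps_word_prod)
  obtain x y where x: "word_prod b x = i" and y: "word_prod b y = Suc i"
    using bij_word_prod[of b] by (metis bij_pointE)
  have xy: "x \<le> i" "\<not> y \<le> i" using kb x y unfolding keeps_def by (metis order_refl, metis Suc_n_not_le_n)
  have "word_prod ws x = word_prod c (Suc i)" "word_prod ws y = word_prod c i"
    by (simp_all add: ws x y simple_reflection_apply)
  moreover have "word_prod ws x \<le> i" "\<not> word_prod ws y \<le> i"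
    using assms(1) xy by (simp_all add: keeps_def)
  ultimately have "word_prod c (Suc i) < word_prod c i" by linarith
  from order_reversal_split[OF this] obtain c1 j c2 where
    c: "c = c1 @ j # c2" and j: "word_prod c2 (Suc i) = Suc j" "word_prod c2 i = j" by auto
  \<comment> \<open>Conjugating s_i by \<open>c2\<close> gives the transposition of \<open>j\<close>
    and \<open>Suc j\<close>, which is s_j; so the two letters cancel around
    \<open>c2\<close>.\<close>
  have "simple_reflection j (word_prod c2 (simple_reflection i z)) = word_prod c2 z" for z
  proof -
    have "word_prod c2 z \<noteq> j" if "z \<noteq> i" using that j(2) by (metis word_prod_eq_iff)
    moreover have "word_prod c2 z \<noteq> Suc j" if "z \<noteq> Suc i" using that j(1) by (metis word_prod_eq_iff)
    ultimately show ?thesis using j by (auto simp: simple_reflection_apply)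
  qed
  then have "word_prod (c1 @ c2 @ b) = word_prod ws" by (auto simp: ws c fun_eq_iff)
  then show ?thesis by (intro exI[of _ "c1 @ c2 @ b"]) (auto simp: ws c)
qed

section \<open>Reduced words and the support\<close>

lemma reduced_word_le: "reduced_word n w ws \<Longrightarrow> is_word n w ws' \<Longrightarrow> length ws \<le> length ws'"
  unfolding reduced_word_def coxeter_length_def by (metis (mono_tags, lifting) Least_le)

lemma ex_reduced_word: "is_word n w ws \<Longrightarrow> \<exists>ws'. reduced_word n w ws'"
  unfolding reduced_word_def coxeter_length_def
  by (rule LeastI_ex[where P = "\<lambda>k. \<exists>ws. is_word n w ws \<and> length ws = k"]) blast

text \<open>A letter \<open>i\<close> with \<open>keeps i w\<close> would allow
  \<open>shorter_word\<close> to shorten the word. In particular all reduced words of w have the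
  same letters.\<close>

lemma set_reduced_word:
  assumes "reduced_word n w ws"
  shows "set ws = {i. \<not> keeps i w}"
proof (intro equalityI subsetI)
  fix i assume i: "i \<in> set ws"
  have w: "is_word n w ws" using assms by (simp add: reduced_word_def)
  show "i \<in> {i. \<not> keeps i w}"
  proof (rule ccontr)
    assume "\<not> ?thesis"
    then have "keeps i (word_prod ws)" using w by (simp add: is_word_def)
    from shorter_word[OF this i] obtain ws' where
      ws': "set ws' \<subseteq> set ws" "length ws' < length ws" "word_prod ws' = word_prod ws" by blast
    then have "is_word n w ws'" using w by (auto simp: is_word_def)
    with reduced_word_le[OF assms] ws'(2) show False by fastforce
  qed
next
  fix i assume "i \<in> {i. \<not> keeps i w}"
  then show "i \<in> set ws"
    using assms keeps_word_prod by (auto simp: reduced_word_def is_word_def)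
qed

lemma is_word_append: "is_word n f xs \<Longrightarrow> is_word n g ys \<Longrightarrow> is_word n (f \<circ> g) (xs @ ys)"
  by (auto simp: is_word_def)

lemma ex_word_transpose:
  assumes "1 \<le> a" "a < b" "b \<le> Suc n"
  shows "\<exists>ws. is_word n (transpose a b) ws"
  using assms(2,3)
proof (induction b rule: less_induct)
  case (less b)
  then obtain c where b: "b = Suc c" by (cases b) auto
  have r: "is_word n (transpose c (Suc c)) [c]"
    using less.prems assms(1) by (auto simp: is_word_def simple_reflection_def b)
  show ?case
  proof (cases "a = c")
    case True
    then show ?thesis using r b by blast
  next
    case False
    then obtain ws where ws: "is_word n (transpose a c) ws" using less b by fastforce
    have "transpose c (Suc c) \<circ> transpose a c \<circ> transpose c (Suc c) = transpose a b"
      using False less.prems by (auto simp: fun_eq_iff transpose_def b)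
    then show ?thesis using is_word_append[OF is_word_append[OF r ws] r] by auto
  qed
qed

text \<open>Guarantees that the \<open>LEAST\<close> in \<open>coxeter_length\<close> is attained,
  so that every element of W has a reduced word.\<close>

lemma ex_word_permutes:
  assumes "w permutes {1..Suc n}"
  shows "\<exists>ws. is_word n w ws"
proof (rule permutes_induct[OF assms finite_atLeastAtMost])
  show "\<exists>ws. is_word n id ws" by (rule exI[of _ "[]"]) (simp add: is_word_def)
next
  fix a b p
  assume ab: "a \<in> {1..Suc n}" "b \<in> {1..Suc n}" and p: "\<exists>ws. is_word n p ws"
  have "\<exists>ws. is_word n (transpose a b) ws"
  proof (rule linorder_cases[of a b])
    assume "a = b"
    then show ?thesis by (intro exI[of _ "[]"]) (simp add: is_word_def)
  next
    assume "a < b" then show ?thesis using ab by (intro ex_word_transpose) auto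
  next
    assume "b < a" 
    then have "\<exists>ws. is_word n (transpose b a) ws" using ab by (intro ex_word_transpose) auto
    then show ?thesis by (simp add: transpose_commute)
  qed
  with p show "\<exists>ws. is_word n (transpose a b \<circ> p) ws" using is_word_append by blast
qed

lemma word_prod_permutes:
  assumes "set ws \<subseteq> {1..n}"
  shows "word_prod ws permutes {1..Suc n}"
  using assms
proof (induction ws)
  case (Cons i ws)
  then have "simple_reflection i permutes {1..Suc n}"
    unfolding simple_reflection_def by (intro permutes_swap_id) auto
  moreover have "word_prod ws permutes {1..Suc n}" using Cons by simp
  ultimately show ?case unfolding word_prod_Cons by (rule permutes_compose[rotated])
qed (simp add: permutes_id)

lemma supp_eq:
  assumes "w \<in> weyl_A n"
  shows "supp n w = {i. \<not> keeps i w}"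
proof -
  obtain ws where "reduced_word n w ws"
    using assms ex_word_permutes ex_reduced_word unfolding weyl_A_def by blast
  moreover have "i \<in> set ws' \<longleftrightarrow> \<not> keeps i w" if "reduced_word n w ws'" for i ws'
    by (simp add: set_reduced_word[OF that])
  ultimately show ?thesis unfolding supp_def by (intro Collect_cong) metis
qed

text \<open>Every letter of \<open>ws\<close> lies in the support of the product, so a reduced word
  has to use all of them and cannot be shorter.\<close>

lemma distinct_reduced_word:
  assumes "distinct ws" "set ws \<subseteq> {1..n}"
  shows "reduced_word n (word_prod ws) ws"
proof -
  have w: "is_word n (word_prod ws) ws" using assms by (simp add: is_word_def)
  obtain ws' where ws': "reduced_word n (word_prod ws) ws'" using ex_reduced_word w by blast
  have "set ws' = set ws" using set_reduced_word[OF ws'] keeps_distinct_iff[OF assms(1)] by simp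
  then have "length ws \<le> length ws'"
    using assms(1) by (metis card_length distinct_card)
  moreover have "length ws' \<le> length ws" using reduced_word_le[OF ws' w] .
  ultimately show ?thesis using ws' w by (simp add: reduced_word_def)
qed

lemma boolean_iff: "boolean n w \<longleftrightarrow> (\<exists>ws. distinct ws \<and> set ws \<subseteq> {1..n} \<and> word_prod ws = w)"
proof
  assume b: "boolean n w"
  then have W: "w \<in> weyl_A n" by (simp add: boolean_def)
  then obtain ws where ws: "reduced_word n w ws"
    using ex_word_permutes ex_reduced_word unfolding weyl_A_def by blast
  have "card (set ws) = length ws"
    using b ws set_reduced_word[OF ws] supp_eq[OF W] by (simp add: boolean_def reduced_word_def)
  then have "distinct ws" by (rule card_distinct)
  with ws show "\<exists>ws. distinct ws \<and> set ws \<subseteq> {1..n} \<and> word_prod ws = w"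
    by (auto simp: reduced_word_def is_word_def)
next
  assume "\<exists>ws. distinct ws \<and> set ws \<subseteq> {1..n} \<and> word_prod ws = w"
  then obtain ws where ws: "distinct ws" "set ws \<subseteq> {1..n}" "word_prod ws = w" by blast
  have W: "w \<in> weyl_A n" using word_prod_permutes ws by (auto simp: weyl_A_def)
  have r: "reduced_word n w ws" using distinct_reduced_word ws by blast
  have "supp n w = set ws" using supp_eq[OF W] set_reduced_word[OF r] by simp
  then show "boolean n w" using W r ws(1)
    by (auto simp: boolean_def reduced_word_def distinct_card)
qed

section \<open>The order of two letters and the diagram of a word\<close>

lemma appears_before_Nil [simp]: "\<not> appears_before j k []"
  by (simp add: appears_before_def)

lemma appears_before_Cons [simp]:
  "appears_before j k (x # xs) \<longleftrightarrow> x = j \<and> k \<in> set xs \<or> appears_before j k xs"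
proof
  assume "appears_before j k (x # xs)"
  then obtain p q where pq: "p < q" "q < length (x # xs)" "(x # xs) ! p = j" "(x # xs) ! q = k"
    unfolding appears_before_def by blast
  then obtain q' where q: "q = Suc q'" by (cases q) auto
  show "x = j \<and> k \<in> set xs \<or> appears_before j k xs"
  proof (cases p)
    case 0
    then show ?thesis using pq q by auto
  next
    case (Suc p')
    then have "appears_before j k xs"
      unfolding appears_before_def using pq q by (intro exI[of _ p'] exI[of _ q']) simp
    then show ?thesis ..
  qed
next
  assume "x = j \<and> k \<in> set xs \<or> appears_before j k xs"
  then show "appears_before j k (x # xs)"
  proof
    assume a: "x = j \<and> k \<in> set xs"
    then obtain q where "q < length xs" "xs ! q = k" by (auto simp: in_set_conv_nth)
    then show ?thesis using a unfolding appears_before_def by (intro exI[of _ 0] exI[of _ "Suc q"]) auto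
  next
    assume "appears_before j k xs"
    then obtain p q where "p < q" "q < length xs" "xs ! p = j" "xs ! q = k"
      unfolding appears_before_def by blast
    then show ?thesis unfolding appears_before_def by (intro exI[of _ "Suc p"] exI[of _ "Suc q"]) auto
  qed
qed

lemma appears_before_append [simp]:
  "appears_before j k (xs @ ys) \<longleftrightarrow>
     appears_before j k xs \<or> appears_before j k ys \<or> j \<in> set xs \<and> k \<in> set ys"
  by (induction xs) auto

lemma appears_before_in_set: "appears_before j k ws \<Longrightarrow> j \<in> set ws \<and> k \<in> set ws"
  by (induction ws) auto

lemma appears_before_total:
  "distinct ws \<Longrightarrow> j \<in> set ws \<Longrightarrow> k \<in> set ws \<Longrightarrow> j \<noteq> k \<Longrightarrow>
     appears_before j k ws \<longleftrightarrow> \<not> appears_before k j ws"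
  by (induction ws) (auto dest: appears_before_in_set)

lemma appears_before_filter:
  "j \<in> X \<Longrightarrow> k \<in> X \<Longrightarrow> appears_before j k (filter (\<lambda>x. x \<in> X) ws) \<longleftrightarrow> appears_before j k ws"
  by (induction ws) auto

lemma appears_before_split:
  assumes "appears_before j k ws"
  shows "\<exists>a b c. ws = a @ j # b @ k # c"
  using assms
proof (induction ws)
  case (Cons x ws)
  show ?case
  proof (cases "x = j \<and> k \<in> set ws")
    case True
    then show ?thesis by (metis append_Nil split_list)
  next
    case False
    then show ?thesis using Cons by (metis appears_before_Cons append_Cons)
  qed
qed simp

text \<open>The rightmost letter acts first. If \<open>i\<close> stands to the right of
  \<open>Suc i\<close>, some strand is lifted from i to i + 1 and then to i + 2, and stays above i +
  1. In the opposite order a strand from \<open>{..i}\<close> ends at i + 1 at most.\<close>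

lemma appears_before_iff_word_prod:
  assumes d: "distinct ws" and i: "i \<in> set ws" "Suc i \<in> set ws"
  shows "appears_before (Suc i) i ws \<longleftrightarrow> (\<exists>x\<le>i. Suc i < word_prod ws x)"
proof
  assume "appears_before (Suc i) i ws"
  then obtain a b c where ws: "ws = a @ Suc i # b @ i # c" using appears_before_split by blast
  have k: "keeps i (word_prod a)" "keeps i (word_prod b)" "keeps i (word_prod c)"
    "keeps (Suc i) (word_prod a)" "keeps (Suc i) (word_prod b)"
    using d by (auto simp: ws intro!: keeps_word_prod)
  obtain x where x: "word_prod c x = i"
    using bij_word_prod[of c] by (metis bij_pointE)
  have "x \<le> i" using k(3) x by (metis keeps_def order_refl)
  \<comment> \<open>\<open>b\<close> preserves both \<open>{..i}\<close> and
    \<open>{..Suc i}\<close>, hence fixes the only point of their difference.\<close>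
  moreover have "word_prod b (Suc i) = Suc i"
    using k(2,5) unfolding keeps_def by (metis Suc_n_not_le_n le_Suc_eq order_refl)
  then have "word_prod ws x = word_prod a (Suc (Suc i))"
    by (simp add: ws x simple_reflection_apply)
  then have "Suc i < word_prod ws x" using k(4) by (simp add: keeps_def not_le[symmetric])
  ultimately show "\<exists>x\<le>i. Suc i < word_prod ws x" by blast
next
  assume "\<exists>x\<le>i. Suc i < word_prod ws x"
  then obtain x where x: "x \<le> i" "Suc i < word_prod ws x" by blast
  show "appears_before (Suc i) i ws"
  proof (rule ccontr)
    assume "\<not> ?thesis"
    then have "appears_before i (Suc i) ws" using appears_before_total[OF d i] by simp
    then obtain a b c where ws: "ws = a @ i # b @ Suc i # c" using appears_before_split by blast
    have k: "keeps i (word_prod b)" "keeps i (word_prod c)" "keeps (Suc i) (word_prod a)"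
      using d by (auto simp: ws intro!: keeps_word_prod)
    have "word_prod c x \<le> i" using k(2) x by (simp add: keeps_def)
    then have "simple_reflection (Suc i) (word_prod c x) = word_prod c x"
      by (simp add: simple_reflection_apply)
    moreover have "word_prod b (word_prod c x) \<le> i"
      using k(1) \<open>word_prod c x \<le> i\<close> by (simp add: keeps_def)
    then have "simple_reflection i (word_prod b (word_prod c x)) \<le> Suc i"
      by (simp add: simple_reflection_apply)
    then have "word_prod a (simple_reflection i (word_prod b (word_prod c x))) \<le> Suc i"
      using k(3) by (simp add: keeps_def)
    ultimately have "word_prod ws x \<le> Suc i" by (simp add: ws)
    with x show False by simp
  qed
qed

definition word_diagram :: "nat list \<Rightarrow> diagram" where
  "word_diagram ws =
     (set ws, {(k, j). k \<in> set ws \<and> j \<in> set ws \<and> adjacent j k \<and> appears_before j k ws})"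

text \<open>The letters are determined by \<open>keeps\<close>, the order of neighbours by
  \<open>appears_before_iff_word_prod\<close>; both see only the product.\<close>

lemma word_diagram_cong:
  assumes "distinct ws" "distinct ws'" "word_prod ws = word_prod ws'"
  shows "word_diagram ws = word_diagram ws'"
proof -
  have s: "set ws = set ws'"
    using keeps_distinct_iff[OF assms(1)] keeps_distinct_iff[OF assms(2)] assms(3) by auto
  have up: "appears_before (Suc i) i ws \<longleftrightarrow> appears_before (Suc i) i ws'"
    if "i \<in> set ws" "Suc i \<in> set ws" for i
    using that s appears_before_iff_word_prod assms by simp
  then have "appears_before i (Suc i) ws \<longleftrightarrow> appears_before i (Suc i) ws'"
    if "i \<in> set ws" "Suc i \<in> set ws" for i
    using that s appears_before_total assms(1,2) by (metis n_not_Suc_n)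
  with up show ?thesis
    unfolding word_diagram_def adjacent_def s by (auto simp: s)
qed

text \<open>Counting letters shows that every reduced word of the product is free of repetitions. So
  all of them have the diagram of \<open>ws\<close>, and the quantifier in
  \<open>boolean_diagram\<close> can be evaluated at \<open>ws\<close>.\<close>

lemma boolean_diagram_word_prod:
  assumes "distinct ws" "set ws \<subseteq> {1..n}"
  shows "boolean_diagram n (word_prod ws) = word_diagram ws"
proof -
  let ?w = "word_prod ws"
  have r: "reduced_word n ?w ws" using distinct_reduced_word assms by blast
  have b: "boolean n ?w" using boolean_iff assms by blast
  then have s: "supp n ?w = set ws"
    using supp_eq set_reduced_word[OF r] by (simp add: boolean_def)
  have d: "word_diagram ws' = word_diagram ws" if "reduced_word n ?w ws'" for ws'
  proof (rule word_diagram_cong)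
    show "distinct ws'"
    proof (rule card_distinct)
      have "set ws' = set ws" using set_reduced_word[OF that] set_reduced_word[OF r] by simp
      moreover have "length ws' = length ws" using that r by (simp add: reduced_word_def)
      ultimately show "card (set ws') = length ws'" using assms(1) by (simp add: distinct_card)
    qed
    show "word_prod ws' = ?w" using that by (simp add: reduced_word_def is_word_def)
  qed (fact assms)
  have "appears_before j k ws' \<longleftrightarrow> appears_before j k ws"
    if "reduced_word n ?w ws'" "adjacent j k" for ws' j k
    using d[OF that(1)] that(2) unfolding word_diagram_def set_eq_iff
    by (auto dest: appears_before_in_set)
  then show ?thesis
    using r unfolding boolean_diagram_def s word_diagram_def by blast
qed

section \<open>Boolean elements are determined by their diagrams\<close>

lemma simple_reflection_commute:
  "\<not> adjacent i j \<Longrightarrow> simple_reflection i \<circ> simple_reflection j = simple_reflection j \<circ> simple_reflection i"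
  by (auto simp: adjacent_def fun_eq_iff simple_reflection_apply)

lemma word_prod_commute:
  "\<forall>j \<in> set c. \<not> adjacent i j \<Longrightarrow> word_prod c \<circ> simple_reflection i = simple_reflection i \<circ> word_prod c"
proof (induction c)
  case (Cons j c)
  then show ?case
    using simple_reflection_commute[of i j] by (simp add: fun_eq_iff)
qed simp

text \<open>A letter of \<open>ys\<close> standing before the first letter \<open>i\<close> of
  \<open>xs\<close> is not adjacent to \<open>i\<close>, as their order would be reversed. So s_i
  commutes to the front of \<open>ys\<close>, and the induction goes on with the rest.\<close>

lemma word_prod_eqI:
  assumes "distinct xs" "distinct ys" "set xs = set ys"
    and "\<And>j k. adjacent j k \<Longrightarrow> appears_before j k xs \<Longrightarrow> appears_before j k ys"
  shows "word_prod xs = word_prod ys"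
  using assms
proof (induction xs arbitrary: ys)
  case (Cons i xs)
  then obtain c d where ys: "ys = c @ i # d" by (metis list.set_intros(1) split_list)
  have id: "i \<notin> set c" "i \<notin> set d" using Cons.prems(2) ys by auto
  have "\<not> adjacent i j" if j: "j \<in> set c" for j
  proof
    assume "adjacent i j"
    moreover have "j \<in> set xs" using Cons.prems(3) j id by (auto simp: ys)
    ultimately have "appears_before i j ys" using Cons.prems(4)[of i j] by simp
    moreover have "j \<notin> set d" using Cons.prems(2) j by (auto simp: ys)
    ultimately show False using id j by (auto simp: ys dest: appears_before_in_set)
  qed
  then have c: "word_prod c \<circ> simple_reflection i = simple_reflection i \<circ> word_prod c"
    by (intro word_prod_commute) simp
  have "word_prod xs = word_prod (c @ d)"
  proof (rule Cons.IH)
    show "set xs = set (c @ d)" using Cons.prems(1,3) id by (auto simp: ys)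
    fix j k assume jk: "adjacent j k" "appears_before j k xs"
    then have "appears_before j k ys" using Cons.prems(4) by simp
    moreover have "j \<noteq> i" "k \<noteq> i" using jk Cons.prems(1) by (auto dest: appears_before_in_set)
    ultimately show "appears_before j k (c @ d)" by (auto simp: ys)
  qed (use Cons.prems in \<open>auto simp: ys\<close>)
  then show ?case using c by (simp add: ys comp_assoc[symmetric])
qed simp

text \<open>\<open>diagram_insertion\<close> chooses its own representatives; injectivity glues
  consecutive insertions into one sequence of elements.\<close>

lemma inj_boolean_diagram:
  assumes "boolean n u" "boolean n v" "boolean_diagram n u = boolean_diagram n v"
  shows "u = v"
proof -
  obtain xs ys where xs: "distinct xs" "set xs \<subseteq> {1..n}" "word_prod xs = u"
    and ys: "distinct ys" "set ys \<subseteq> {1..n}" "word_prod ys = v"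
    using assms(1,2) unfolding boolean_iff by blast
  have e: "word_diagram xs = word_diagram ys"
    using assms(3) boolean_diagram_word_prod xs ys by metis
  have "word_prod xs = word_prod ys"
  proof (rule word_prod_eqI)
    show "set xs = set ys" using e by (simp add: word_diagram_def)
    fix j k assume "adjacent j k" "appears_before j k xs"
    then show "appears_before j k ys"
      using e appears_before_in_set[of j k xs] by (auto simp: word_diagram_def set_eq_iff)
  qed (fact xs ys)+
  with xs ys show ?thesis by simp
qed

section \<open>Diagrams below B(w) as sets of vertices\<close>

definition induced :: "diagram \<Rightarrow> nat set \<Rightarrow> diagram" where
  "induced W X = (X, arrows W \<inter> X \<times> X)"

lemma boolean_diagramE:
  assumes "boolean n w"
  obtains ws where "distinct ws" "set ws \<subseteq> {1..n}" "word_prod ws = w"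
    "boolean_diagram n w = word_diagram ws"
  using assms boolean_diagram_word_prod unfolding boolean_iff by metis

lemma vertices_boolean_diagram [simp]: "vertices (boolean_diagram n w) = supp n w"
  by (simp add: boolean_diagram_def)

lemma supp_subset: "supp n w \<subseteq> {1..n}"
  by (auto simp: supp_def reduced_word_def is_word_def)

lemma finite_supp [simp]: "finite (supp n w)"
  using supp_subset finite_subset by blast

lemma arrows_boolean_diagramD:
  "(k, j) \<in> arrows (boolean_diagram n w) \<Longrightarrow> k \<in> supp n w \<and> j \<in> supp n w \<and> adjacent k j"
  by (auto simp: boolean_diagram_def adjacent_def)

text \<open>The diagrams of boolean elements are the subsets of \<open>{1..n}\<close> with an orientation of every
  pair of adjacent vertices.\<close>

lemma arrow_orientation:
  assumes "boolean n w" "k \<in> supp n w" "j \<in> supp n w" "adjacent k j"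
  shows "(k, j) \<in> arrows (boolean_diagram n w) \<longleftrightarrow> (j, k) \<notin> arrows (boolean_diagram n w)"
proof -
  obtain ws where ws: "distinct ws" "boolean_diagram n w = word_diagram ws"
    using assms(1) by (rule boolean_diagramE)
  have "set ws = supp n w"
    using arg_cong[OF ws(2), of fst] by (simp add: word_diagram_def)
  moreover have "adjacent j k" "k \<noteq> j" using assms(4) by (auto simp: adjacent_def)
  ultimately show ?thesis
    using assms appears_before_total[OF ws(1), of j k] by (auto simp: ws(2) word_diagram_def)
qed

lemma coxeter_length_boolean: "boolean n w \<Longrightarrow> coxeter_length n w = card (supp n w)"
  by (simp add: boolean_def)

lemma ex_boolean_induced:
  assumes "boolean n w" "X \<subseteq> supp n w"
  shows "\<exists>x. boolean n x \<and> boolean_diagram n x = induced (boolean_diagram n w) X"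
proof -
  obtain ws where ws: "distinct ws" "set ws \<subseteq> {1..n}" "boolean_diagram n w = word_diagram ws"
    using assms(1) by (rule boolean_diagramE)
  \<comment> \<open>Deleting the letters outside \<open>X\<close> keeps the order of the others, so
    the product of the remaining word has the induced diagram.\<close>
  let ?f = "filter (\<lambda>x. x \<in> X) ws"
  have f: "distinct ?f" "set ?f \<subseteq> {1..n}" using ws by auto
  have s: "set ws = supp n w"
    using arg_cong[OF ws(3), of fst] by (simp add: word_diagram_def)
  have "word_diagram ?f = induced (word_diagram ws) X"
    using assms(2) by (auto simp: word_diagram_def induced_def s appears_before_filter)
  then show ?thesis using f boolean_iff boolean_diagram_word_prod ws(3) by metis
qed

text \<open>An arrow of B(w) between two vertices of B(u) cannot be missing in B(u): the opposite
  arrow would be there instead, and B(w) would contain both.\<close>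

lemma eq_inducedI:
  assumes "boolean n u" "boolean n w" "subdiagram (boolean_diagram n u) (boolean_diagram n w)"
  shows "boolean_diagram n u = induced (boolean_diagram n w) (supp n u)"
proof (rule prod_eqI)
  have v: "supp n u \<subseteq> supp n w" and a: "arrows (boolean_diagram n u) \<subseteq> arrows (boolean_diagram n w)"
    using assms(3) by (auto simp: subdiagram_def)
  show "arrows (boolean_diagram n u) = arrows (induced (boolean_diagram n w) (supp n u))"
  proof (intro equalityI subsetI)
    fix e assume e: "e \<in> arrows (boolean_diagram n u)"
    then show "e \<in> arrows (induced (boolean_diagram n w) (supp n u))"
      using a by (cases e) (auto simp: induced_def dest: arrows_boolean_diagramD)
  next
    fix e assume e: "e \<in> arrows (induced (boolean_diagram n w) (supp n u))"
    obtain k j where kj: "e = (k, j)" by fastforce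
    have w: "k \<in> supp n u" "j \<in> supp n u" "(k, j) \<in> arrows (boolean_diagram n w)"
      using e by (auto simp: kj induced_def)
    have adj: "adjacent k j" using w(3) arrows_boolean_diagramD by blast
    have "(j, k) \<notin> arrows (boolean_diagram n w)"
      using arrow_orientation[OF assms(2) _ _ adj] w v by blast
    then have "(j, k) \<notin> arrows (boolean_diagram n u)" using a by blast
    then show "e \<in> arrows (boolean_diagram n u)"
      using arrow_orientation[OF assms(1) _ _ adj] w by (simp add: kj)
  qed
qed (simp add: induced_def)

section \<open>Targets and the exchange argument\<close>

text \<open>Rules (1) and (3) for diagrams below W. The path runs in the diagram induced on
  \<open>insert j X\<close> because rule (1) asks for a path in the diagram after the
  insertion.\<close>

definition targets :: "diagram \<Rightarrow> nat set \<Rightarrow> nat \<Rightarrow> nat set" where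
  "targets W X i =
     (if i \<in> X then {j \<in> vertices W - X. (i, j) \<in> (arrows (induced W (insert j X)))\<^sup>*}
      else {i} \<inter> vertices W)"

lemma arrows_induced_mono: "X \<subseteq> Y \<Longrightarrow> arrows (induced W X) \<subseteq> arrows (induced W Y)"
  by (auto simp: induced_def)

lemma reach_mono:
  "(i, j) \<in> (arrows (induced W X))\<^sup>* \<Longrightarrow> X \<subseteq> Y \<Longrightarrow> (i, j) \<in> (arrows (induced W Y))\<^sup>*"
  using rtrancl_mono[OF arrows_induced_mono] by blast

lemma targetsD: "j \<in> targets W X i \<Longrightarrow> j \<in> vertices W \<and> j \<notin> X"
  by (auto simp: targets_def split: if_splits)

lemma first_exit:
  assumes "(i, k) \<in> (arrows (induced W Z))\<^sup>*" "i \<in> X" "k \<notin> X"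
  shows "\<exists>j \<in> Z - X. (i, j) \<in> (arrows (induced W (insert j X)))\<^sup>* \<and>
                     (j, k) \<in> (arrows (induced W Z))\<^sup>*"
  using assms
proof (induction rule: converse_rtrancl_induct)
  case (step i y)
  then have e: "(i, y) \<in> arrows W" "i \<in> Z" "y \<in> Z" by (auto simp: induced_def)
  show ?case
  proof (cases "y \<in> X")
    case True
    then obtain j where j: "j \<in> Z - X" "(y, j) \<in> (arrows (induced W (insert j X)))\<^sup>*"
      "(j, k) \<in> (arrows (induced W Z))\<^sup>*" using step by blast
    have "(i, y) \<in> arrows (induced W (insert j X))"
      using e True step.prems by (auto simp: induced_def)
    with j show ?thesis by (meson converse_rtrancl_into_rtrancl)
  next
    case False
    have "(i, y) \<in> arrows (induced W (insert y X))"
      using e step.prems by (auto simp: induced_def)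
    with False e step.hyps show ?thesis by blast
  qed
qed auto

lemma targets_mono:
  assumes "j \<in> targets W X i" "X \<subseteq> Y" "j \<notin> Y"
  shows "j \<in> targets W Y i"
proof (cases "i \<in> X")
  case True
  then have "(i, j) \<in> (arrows (induced W (insert j X)))\<^sup>*" "j \<in> vertices W"
    using assms by (auto simp: targets_def)
  then have "(i, j) \<in> (arrows (induced W (insert j Y)))\<^sup>*"
    by (rule_tac reach_mono) (use assms in auto)
  with True assms \<open>j \<in> vertices W\<close> show ?thesis by (auto simp: targets_def)
next
  case False
  with assms show ?thesis by (auto simp: targets_def)
qed

text \<open>A path to the later target \<open>k\<close>, cut where it first leaves the smaller set
  \<open>X\<close>, ends in an earlier target \<open>j\<close>, from which the rest of the path
  leads to \<open>k\<close>.\<close>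

lemma targets_antimono:
  assumes "k \<in> targets W Y i" "X \<subseteq> Y" "Y \<subseteq> vertices W" "i \<in> X \<or> i \<notin> Y"
  shows "\<exists>j \<in> targets W X i. j = k \<or> j \<in> Y \<and> (j, k) \<in> (arrows (induced W (insert k Y)))\<^sup>*"
proof (cases "i \<in> X")
  case True
  then have "i \<in> Y" using assms by blast
  then have k: "(i, k) \<in> (arrows (induced W (insert k Y)))\<^sup>*" "k \<in> vertices W" "k \<notin> X"
    using assms by (auto simp: targets_def)
  from first_exit[OF k(1) True k(3)] obtain j where
    "j \<in> insert k Y - X" "(i, j) \<in> (arrows (induced W (insert j X)))\<^sup>*"
    "(j, k) \<in> (arrows (induced W (insert k Y)))\<^sup>*" by blast
  with True k assms show ?thesis by (intro bexI[of _ j]) (auto simp: targets_def)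
next
  case False
  with assms show ?thesis by (auto simp: targets_def)
qed

lemma targets_insert_empty:
  assumes "targets W X i = {}" "insert j X \<subseteq> vertices W"
  shows "targets W (insert j X) i = {}"
proof (rule ccontr)
  assume "\<not> ?thesis"
  then obtain k where k: "k \<in> targets W (insert j X) i" by blast
  show False
  proof (cases "i \<in> X \<or> i \<notin> insert j X")
    case True
    with targets_antimono[OF k _ assms(2) True] assms(1) show False by blast
  next
    case False
    \<comment> \<open>Here \<open>i = j\<close> is the new vertex, which was its own target before
      it was added.\<close>
    with assms show False by (auto simp: targets_def split: if_splits)
  qed
qed

text \<open>Existence of an insertion path from the diagram on \<open>X\<close> to W using each
  index of \<open>S\<close> once, with the elements and the order of the indices forgotten.\<close>

inductive completable :: "diagram \<Rightarrow> nat set \<Rightarrow> nat set \<Rightarrow> bool" for W where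
  all_vertices: "completable W (vertices W) {}"
| step: "j \<in> targets W X i \<Longrightarrow> i \<notin> S \<Longrightarrow> completable W (insert j X) S \<Longrightarrow>
           completable W X (insert i S)"

lemma completable_subset: "completable W X S \<Longrightarrow> X \<subseteq> vertices W"
  by (induction rule: completable.induct) auto

lemma completable_empty: "completable W X {} \<longleftrightarrow> X = vertices W"
  by (auto elim: completable.cases intro: completable.all_vertices)

lemma completable_card:
  assumes "completable W X S" "finite (vertices W)"
  shows "finite S \<and> card S = card (vertices W - X)"
  using assms
proof (induction rule: completable.induct)
  case (step j X i S)
  have "vertices W - X = insert j (vertices W - insert j X)"
    using targetsD[OF step.hyps(1)] by blast
  then have "card (vertices W - X) = Suc (card (vertices W - insert j X))"
    using step.prems by (metis Diff_iff card_insert_disjoint finite_Diff insertI1)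
  then show ?case using step by simp
qed simp

lemma completable_no_target:
  assumes "completable W X S" "targets W X i = {}"
  shows "i \<notin> S"
  using assms
proof (induction rule: completable.induct)
  case (step j X b S)
  have "targets W (insert j X) i = {}"
    using step.prems completable_subset[OF step.hyps(3)] by (rule targets_insert_empty)
  with step show ?case by auto
qed simp

text \<open>The step at \<open>i\<close> in the given derivation is handed to \<open>b\<close>. The
  last assumption allows this at whatever stage \<open>Y\<close> that step occurs.\<close>

lemma completable_relabel:
  assumes "completable W X S" "i \<in> S" "b \<notin> S"
    and "\<And>Y. X \<subseteq> Y \<Longrightarrow> Y \<subseteq> vertices W \<Longrightarrow> targets W Y i \<subseteq> targets W Y b"
  shows "completable W X (insert b (S - {i}))"
  using assms
proof (induction rule: completable.induct)
  case (step j X c S)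
  have X: "insert j X \<subseteq> vertices W" using completable_subset[OF step.hyps(3)] .
  show ?case
  proof (cases "c = i")
    case True
    then have "j \<in> targets W X b" using step.hyps(1) step.prems(3)[of X] X by auto
    then have "completable W X (insert b S)"
      using step by (intro completable.step) auto
    then show ?thesis using True step.hyps(2) by simp
  next
    case False
    have "completable W (insert j X) (insert b (S - {i}))"
      by (rule step.IH) (use step.prems False in auto)
    then have "completable W X (insert c (insert b (S - {i})))"
      by (rule completable.step[OF step.hyps(1), rotated]) (use step False in auto)
    then show ?thesis using False by (simp add: insert_commute insert_Diff_if)
  qed
qed simp

text \<open>A forced insertion may be performed first. If the given order adds \<open>j\<close> at another index \<open>b\<close>
  before \<open>i\<close> is used, then \<open>b\<close> reaches all later targets of \<open>i\<close> through \<open>j\<close>, so that the two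
  indices can be exchanged.\<close>

lemma completable_forced:
  assumes "completable W X S" "i \<in> S" "targets W X i = {j}"
  shows "completable W (insert j X) (S - {i})"
  using assms
proof (induction rule: completable.induct)
  case (step k X b S)
  have X: "insert k X \<subseteq> vertices W" using completable_subset[OF step.hyps(3)] .
  have j: "j \<in> vertices W" "j \<notin> X" using targetsD[of j W X i] step.prems by auto
  have "j \<in> targets W X i" using step.prems(2) by simp
  then have ij: "i \<in> X \<or> i = j" by (auto simp: targets_def split: if_splits)
  consider "b = i" | "b \<noteq> i" "k \<noteq> j" | "b \<noteq> i" "k = j" by blast
  then show ?case
  proof cases
    case 1
    then show ?thesis using step by simp
  next
    case 2
    \<comment> \<open>Adding another vertex \<open>k\<close> leaves \<open>i\<close> forced: a path
      to any target would have to leave \<open>X\<close> at \<open>j\<close>, which is still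
      missing. Hence the two steps can be swapped.\<close>
    have "targets W (insert k X) i = {j}"
    proof (intro equalityI subsetI)
      fix l assume l: "l \<in> targets W (insert k X) i"
      have "i \<in> X \<or> i \<notin> insert k X" using ij j 2 by auto
      from targets_antimono[OF l _ X this] step.prems(2) j 2 show "l \<in> {j}" by auto
    next
      fix l assume "l \<in> {j}"
      then show "l \<in> targets W (insert k X) i"
        using targets_mono[of j W X i "insert k X"] step.prems j 2 by auto
    qed
    then have "completable W (insert k (insert j X)) (S - {i})"
      using step.IH step.prems 2 by (simp add: insert_commute)
    moreover have "k \<in> targets W (insert j X) b"
      using targets_mono[OF step.hyps(1), of "insert j X"] targetsD[OF step.hyps(1)] 2 by auto
    ultimately have "completable W (insert j X) (insert b (S - {i}))"
      using step.hyps(2) by (intro completable.step) auto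
    then show ?thesis using 2 by (simp add: insert_Diff_if)
  next
    case 3
    have "completable W (insert j X) (insert b (S - {i}))"
    proof (rule completable_relabel)
      show "completable W (insert j X) S" using step.hyps(3) 3 by simp
      show "i \<in> S" "b \<notin> S" using step 3 by auto
      fix Y assume Y: "insert j X \<subseteq> Y" "Y \<subseteq> vertices W"
      show "targets W Y i \<subseteq> targets W Y b"
      proof
        fix l assume l: "l \<in> targets W Y i"
        then have l': "l \<in> vertices W" "l \<notin> Y" using targetsD by auto
        \<comment> \<open>If \<open>i\<close> lies in \<open>X\<close>, the path leaves
          \<open>X\<close> through its only exit \<open>j\<close>; otherwise \<open>i\<close> is
          \<open>j\<close> itself.\<close>
        have "(j, l) \<in> (arrows (induced W (insert l Y)))\<^sup>*"
        proof (cases "i \<in> X")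
          case True
          with targets_antimono[OF l _ Y(2), of X] Y(1) step.prems(2) l'(2) show ?thesis by auto
        next
          case False
          then show ?thesis using ij l Y by (auto simp: targets_def split: if_splits)
        qed
        \<comment> \<open>Likewise \<open>b\<close> reaches \<open>j\<close> through
          \<open>X\<close>, or it has added itself, so that \<open>b = j\<close>.\<close>
        moreover have bj: "b \<in> Y \<and> (b, j) \<in> (arrows (induced W (insert l Y)))\<^sup>*"
        proof (cases "b \<in> X")
          case True
          then have "(b, j) \<in> (arrows (induced W (insert j X)))\<^sup>*"
            using step.hyps(1) 3 by (auto simp: targets_def)
          then have "(b, j) \<in> (arrows (induced W (insert l Y)))\<^sup>*"
            by (rule reach_mono) (use Y in auto)
          with True Y show ?thesis by auto
        next
          case False
          then show ?thesis using step.hyps(1) 3 Y by (auto simp: targets_def)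
        qed
        ultimately have "(b, l) \<in> (arrows (induced W (insert l Y)))\<^sup>*" by (meson rtrancl_trans)
        with bj l' show "l \<in> targets W Y b" by (auto simp: targets_def)
      qed
    qed
    then show ?thesis using 3 by (simp add: insert_Diff_if)
  qed
qed simp

section \<open>Insertions between elements as steps between vertex sets\<close>

lemma vertices_induced [simp]: "vertices (induced W X) = X"
  by (simp add: induced_def)

lemma induced_inject [simp]: "induced W X = induced W Y \<longleftrightarrow> X = Y"
  by (auto simp: induced_def)

lemma induced_supp [simp]: "induced (boolean_diagram n w) (supp n w) = boolean_diagram n w"
  by (rule prod_eqI) (auto simp: induced_def dest: arrows_boolean_diagramD)

lemma subdiagram_refl: "subdiagram B B"
  by (simp add: subdiagram_def)

lemma subdiagram_trans: "subdiagram B C \<Longrightarrow> subdiagram C D \<Longrightarrow> subdiagram B D"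
  by (auto simp: subdiagram_def)

lemma boolean_insertion_target:
  assumes "boolean_insertion n x i y" "boolean n w"
    "subdiagram (boolean_diagram n y) (boolean_diagram n w)"
  shows "\<exists>j \<in> targets (boolean_diagram n w) (supp n x) i. supp n y = insert j (supp n x)"
proof -
  let ?W = "boolean_diagram n w"
  have xy: "boolean n y" "supp n x \<subseteq> supp n y"
    using assms(1) by (auto simp: boolean_insertion_def subdiagram_def)
  obtain j where j: "supp n y - supp n x = {j}"
    "if i \<in> supp n x then (i, j) \<in> (arrows (boolean_diagram n y))\<^sup>* else i = j"
    using assms(1) unfolding boolean_insertion_def by metis
  have s: "supp n y = insert j (supp n x)" using j(1) xy(2) by blast
  moreover have "boolean_diagram n y = induced ?W (supp n y)"
    using eq_inducedI[OF xy(1) assms(2,3)] .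
  moreover have "j \<in> supp n w" using assms(3) j(1) by (auto simp: subdiagram_def)
  moreover have "j \<notin> supp n x" using j(1) by blast
  ultimately have "j \<in> targets ?W (supp n x) i" using j(2) by (simp add: targets_def split: if_splits)
  with s show ?thesis by blast
qed

text \<open>All diagrams below B(w) are induced, so choosing the next diagram means choosing its new
  vertex. This turns the uniqueness test of step (3) into a question about targets.\<close>

lemma insertions_below_induced:
  assumes w: "boolean n w" and X: "X \<subseteq> supp n w" and i: "i \<in> {1..n}"
  shows "insertions_below n (boolean_diagram n w) (induced (boolean_diagram n w) X) i =
         (\<lambda>j. induced (boolean_diagram n w) (insert j X)) ` targets (boolean_diagram n w) X i"
proof (intro equalityI subsetI)
  let ?W = "boolean_diagram n w"
  fix B assume "B \<in> insertions_below n ?W (induced ?W X) i"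
  then obtain x y where xy: "boolean_insertion n x i y" "induced ?W X = boolean_diagram n x"
    "B = boolean_diagram n y" "subdiagram (boolean_diagram n y) ?W"
    by (auto simp: insertions_below_def diagram_insertion_def)
  have x: "supp n x = X" using arg_cong[OF xy(2), of fst] by simp
  have "B = induced ?W (supp n y)"
    using xy eq_inducedI[OF _ w xy(4)] by (auto simp: boolean_insertion_def)
  with boolean_insertion_target[OF xy(1) w xy(4)] x
  show "B \<in> (\<lambda>j. induced ?W (insert j X)) ` targets ?W X i" by auto
next
  let ?W = "boolean_diagram n w"
  fix B assume "B \<in> (\<lambda>j. induced ?W (insert j X)) ` targets ?W X i"
  then obtain j where j: "j \<in> targets ?W X i" "B = induced ?W (insert j X)" by blast
  have j': "j \<in> supp n w" "j \<notin> X" using targetsD[OF j(1)] by auto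
  obtain x where x: "boolean n x" "boolean_diagram n x = induced ?W X"
    using ex_boolean_induced[OF w X] by blast
  obtain y where y: "boolean n y" "boolean_diagram n y = induced ?W (insert j X)"
    using ex_boolean_induced[OF w, of "insert j X"] X j' by blast
  have s: "supp n x = X" "supp n y = insert j X"
    using arg_cong[OF x(2), of fst] arg_cong[OF y(2), of fst] by auto
  have "boolean_insertion n x i y"
    unfolding boolean_insertion_def coxeter_length_boolean[OF x(1)] coxeter_length_boolean[OF y(1)] s
    using x y i j j' finite_subset[OF X]
    by (auto simp: targets_def subdiagram_def induced_def split: if_splits)
  moreover have "subdiagram B ?W"
    using X j' by (auto simp: j subdiagram_def induced_def)
  ultimately show "B \<in> insertions_below n ?W (induced ?W X) i"
    using x(2) y(2) j(2) unfolding insertions_below_def diagram_insertion_def by force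
qed

text \<open>An insertion path without conditions on its end points and its set of indices, so that
  it can be cut at the front and extended at the end.\<close>

definition insertion_chain :: "nat \<Rightarrow> (nat \<Rightarrow> nat) list \<Rightarrow> nat list \<Rightarrow> bool" where
  "insertion_chain n us bs \<longleftrightarrow> length us = Suc (length bs) \<and>
     (\<forall>k < length bs. boolean_insertion n (us ! k) (bs ! k) (us ! Suc k))"

lemma boolean_insertion_path_iff:
  "boolean_insertion_path n u v w us bs \<longleftrightarrow>
     distinct bs \<and> set bs = supp n v \<and> insertion_chain n us bs \<and> us ! 0 = u \<and> us ! length bs = w"
  by (auto simp: boolean_insertion_path_def insertion_chain_def)

text \<open>Going backwards from w, vertices and arrows only get lost; so all intermediate diagrams
  lie below B(w), and each insertion adds a target.\<close>

lemma completable_insertion_chain: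
  assumes "insertion_chain n us bs" "distinct bs" "us ! length bs = w" "boolean n w"
  shows "subdiagram (boolean_diagram n (us ! 0)) (boolean_diagram n w) \<and>
         completable (boolean_diagram n w) (supp n (us ! 0)) (set bs)"
  using assms
proof (induction bs arbitrary: us)
  case Nil
  then show ?case
    using subdiagram_refl completable_empty by simp
next
  case (Cons b bs)
  then obtain x us' where us: "us = x # us'" by (cases us) (auto simp: insertion_chain_def)
  have k: "boolean_insertion n ((x # us') ! k) ((b # bs) ! k) (us' ! k)" if "k \<le> length bs" for k
    using Cons.prems(1) that by (auto simp: insertion_chain_def us)
  have ins: "boolean_insertion n x b (us' ! 0)" using k[of 0] by simp
  have "insertion_chain n us' bs"
    using Cons.prems(1) k[of "Suc _"] by (auto simp: insertion_chain_def us)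
  with Cons have IH: "subdiagram (boolean_diagram n (us' ! 0)) (boolean_diagram n w)"
    "completable (boolean_diagram n w) (supp n (us' ! 0)) (set bs)" by (auto simp: us)
  from boolean_insertion_target[OF ins Cons.prems(4) IH(1)] IH(2) Cons.prems(2)
  have "completable (boolean_diagram n w) (supp n x) (set (b # bs))"
    by (auto intro: completable.step)
  moreover have "subdiagram (boolean_diagram n x) (boolean_diagram n w)"
    using ins IH(1) by (auto simp: boolean_insertion_def intro: subdiagram_trans)
  ultimately show ?case by (simp add: us)
qed

text \<open>Ties the purely diagrammatic record \<open>P\<close> to the elements of W of which
  \<open>boolean_insertion_path\<close> speaks.\<close>

definition records_chain ::
  "nat \<Rightarrow> (nat \<Rightarrow> nat) \<Rightarrow> diagram \<Rightarrow> step list \<Rightarrow> nat list \<Rightarrow> bool" where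
  "records_chain n u B P bs \<longleftrightarrow> (\<exists>us. insertion_chain n us bs \<and> us ! 0 = u \<and>
     boolean n (us ! length bs) \<and> boolean_diagram n (us ! length bs) = B \<and> P = path_steps n us bs)"

lemma records_chain_Nil: "boolean n u \<Longrightarrow> records_chain n u (boolean_diagram n u) [] []"
  unfolding records_chain_def
  by (intro exI[of _ "[u]"]) (simp add: insertion_chain_def path_steps_def)

lemma records_chain_snoc:
  assumes "records_chain n u B P bs" "diagram_insertion n B i B'"
  shows "records_chain n u B' (P @ [(B, i, B')]) (bs @ [i])"
proof -
  obtain us where us: "insertion_chain n us bs" "us ! 0 = u" "boolean n (us ! length bs)"
    "boolean_diagram n (us ! length bs) = B" "P = path_steps n us bs"
    using assms(1) by (auto simp: records_chain_def)
  obtain x y where xy: "boolean_insertion n x i y" "B = boolean_diagram n x" "B' = boolean_diagram n y"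
    using assms(2) by (auto simp: diagram_insertion_def)
  have b: "boolean n x" "boolean n y" using xy(1) by (auto simp: boolean_insertion_def)
  have x: "x = us ! length bs" using inj_boolean_diagram b us xy by metis
  have l: "length us = Suc (length bs)" using us by (simp add: insertion_chain_def)
  have "insertion_chain n (us @ [y]) (bs @ [i])"
    using us(1) xy(1) by (auto simp: insertion_chain_def nth_append x less_Suc_eq)
  moreover have "path_steps n (us @ [y]) (bs @ [i]) = P @ [(B, i, B')]"
    using l us xy by (auto simp: path_steps_def nth_append)
  moreover have "(us @ [y]) ! length (bs @ [i]) = y" "(us @ [y]) ! 0 = u"
    using l us by (auto simp: nth_append)
  ultimately show ?thesis unfolding records_chain_def using b xy by metis
qed

section \<open>Correctness of the algorithm\<close>

lemma inj_on_insertions: "inj_on (\<lambda>j. induced W (insert j X)) (targets W X i)"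
proof (rule inj_onI)
  fix j k assume "j \<in> targets W X i" "k \<in> targets W X i"
    and "induced W (insert j X) = induced W (insert k X)"
  then show "j = k" using targetsD[of j W X i] targetsD[of k W X i] by auto
qed

lemma forced_pass_none:
  assumes "boolean n w" "X \<subseteq> supp n w" "i \<in> {1..n}" "targets (boolean_diagram n w) X i = {}"
  shows "forced_pass n (boolean_diagram n w) (induced (boolean_diagram n w) X) P (i # L) = None"
  using insertions_below_induced[OF assms(1-3)] assms(4) by simp

lemma forced_pass_forced:
  assumes "boolean n w" "X \<subseteq> supp n w" "i \<in> {1..n}" "targets (boolean_diagram n w) X i = {j}"
  shows "forced_pass n (boolean_diagram n w) (induced (boolean_diagram n w) X) P (i # L) =
    forced_pass n (boolean_diagram n w) (induced (boolean_diagram n w) (insert j X))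
      (P @ [(induced (boolean_diagram n w) X, i, induced (boolean_diagram n w) (insert j X))]) L"
  using insertions_below_induced[OF assms(1-3)] assms(4) by (simp add: Let_def)

lemma forced_pass_several:
  assumes "boolean n w" "X \<subseteq> supp n w" "i \<in> {1..n}"
    "j \<in> targets (boolean_diagram n w) X i" "k \<in> targets (boolean_diagram n w) X i" "j \<noteq> k"
  shows "forced_pass n (boolean_diagram n w) (induced (boolean_diagram n w) X) P (i # L) =
    map_option (\<lambda>(B, P, L). (B, P, i # L))
      (forced_pass n (boolean_diagram n w) (induced (boolean_diagram n w) X) P L)"
proof -
  let ?W = "boolean_diagram n w"
  let ?I = "insertions_below n ?W (induced ?W X) i"
  have I: "induced ?W (insert j X) \<in> ?I" "induced ?W (insert k X) \<in> ?I"
    using insertions_below_induced[OF assms(1-3)] assms(4,5) by auto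
  moreover have "induced ?W (insert j X) \<noteq> induced ?W (insert k X)"
    using assms(4-6) inj_on_insertions by (metis inj_onD)
  ultimately have "?I \<noteq> {}" "\<not> (\<exists>!B. B \<in> ?I)" by blast+
  then show ?thesis by (auto split: option.splits)
qed

text \<open>A pass that shortens nothing has met every index at the unchanged diagram
  \<open>B\<close>. The last pass is therefore a certificate that all remaining indices have several
  insertions at one and the same diagram.\<close>

lemma forced_pass_length:
  assumes "forced_pass n W B P L = Some (B', P', L')"
  shows "length L' \<le> length L \<and> (length L' = length L \<longrightarrow> B' = B \<and> P' = P \<and> L' = L \<and>
           (\<forall>i \<in> set L. insertions_below n W B i \<noteq> {} \<and> \<not> (\<exists>!C. C \<in> insertions_below n W B i)))"
  using assms
proof (induction L arbitrary: B P B' P' L')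
  case (Cons i L)
  let ?I = "insertions_below n W B i"
  have ne: "?I \<noteq> {}" using Cons.prems by (auto split: if_splits)
  show ?case
  proof (cases "\<exists>!C. C \<in> ?I")
    case True
    then have "forced_pass n W (the_elem ?I) (P @ [(B, i, the_elem ?I)]) L = Some (B', P', L')"
      using Cons.prems ne by (simp add: Let_def)
    from Cons.IH[OF this] show ?thesis by simp
  next
    case False
    then obtain L'' where "forced_pass n W B P L = Some (B', P', L'')" "L' = i # L''"
      using Cons.prems ne by (auto split: option.splits)
    with Cons.IH[OF this(1)] ne False show ?thesis by auto
  qed
qed simp

text \<open>The invariant of a traversal: \<open>bs\<close> are the indices used before it,
  \<open>cs\<close> those used in it. It quantifies over all \<open>R\<close> above
  \<open>set L\<close> because indices kept earlier in the traversal are no longer in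
  \<open>L\<close> but still have to be inserted.\<close>

definition pass_outcome :: "nat \<Rightarrow> (nat \<Rightarrow> nat) \<Rightarrow> diagram \<Rightarrow> nat set \<Rightarrow> nat list \<Rightarrow> nat list \<Rightarrow>
    (diagram \<times> step list \<times> nat list) option \<Rightarrow> bool" where
  "pass_outcome n u W X bs L r \<longleftrightarrow>
     (case r of
        None \<Rightarrow> \<forall>R. set L \<subseteq> R \<longrightarrow> \<not> completable W X R
      | Some (B', P', L') \<Rightarrow> \<exists>X' cs. X' \<subseteq> vertices W \<and> B' = induced W X' \<and>
          distinct L' \<and> set L' \<subseteq> set L \<and> distinct cs \<and> set cs = set L - set L' \<and>
          records_chain n u B' P' (bs @ cs) \<and>
          (\<forall>R. set L \<subseteq> R \<longrightarrow> completable W X R \<longrightarrow> completable W X' (R - set cs)))"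

lemma pass_outcome_trans:
  assumes X': "\<And>R. set L \<subseteq> R \<Longrightarrow> completable W X R \<Longrightarrow> completable W X' (R - set cs)"
    and cs: "distinct cs" "set cs = set L - set L'" "set L' \<subseteq> set L"
    and r: "pass_outcome n u W X' (bs @ cs) L' r"
  shows "pass_outcome n u W X bs L r"
proof (cases r)
  case None
  have "\<not> completable W X R" if "set L \<subseteq> R" for R
  proof
    assume "completable W X R"
    then have "completable W X' (R - set cs)" using X' that by blast
    moreover have "set L' \<subseteq> R - set cs" using cs that by blast
    ultimately show False using r None by (simp add: pass_outcome_def)
  qed
  then show ?thesis by (simp add: pass_outcome_def None)
next
  case (Some a)
  obtain B'' P'' L'' where a: "a = (B'', P'', L'')" by (cases a)
  obtain X'' ds where X'': "X'' \<subseteq> vertices W" "B'' = induced W X''" "distinct L''"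
    "set L'' \<subseteq> set L'" "distinct ds" "set ds = set L' - set L''"
    "records_chain n u B'' P'' ((bs @ cs) @ ds)"
    and compl: "\<And>R. set L' \<subseteq> R \<Longrightarrow> completable W X' R \<Longrightarrow> completable W X'' (R - set ds)"
    using r unfolding pass_outcome_def Some a by auto
  have "completable W X'' (R - set (cs @ ds))" if "set L \<subseteq> R" "completable W X R" for R
  proof -
    have "set L' \<subseteq> R - set cs" using cs that by blast
    then have "completable W X'' (R - set cs - set ds)" using compl X' that by blast
    then show ?thesis by (simp add: Diff_Diff_Int Diff_eq Int_assoc)
  qed
  moreover have "distinct (cs @ ds)" "set (cs @ ds) = set L - set L''" "set L'' \<subseteq> set L"
    using cs X''(4-6) by auto
  ultimately show ?thesis
    unfolding pass_outcome_def Some a using X''(1-3,7)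
    by (auto intro!: exI[of _ X''] exI[of _ "cs @ ds"])
qed

lemma pass_outcome_keep:
  assumes "pass_outcome n u W X bs L r" "i \<notin> set L"
  shows "pass_outcome n u W X bs (i # L) (map_option (\<lambda>(B, P, L). (B, P, i # L)) r)"
proof (cases r)
  case None
  then show ?thesis using assms by (auto simp: pass_outcome_def)
next
  case (Some a)
  obtain B' P' L' where a: "a = (B', P', L')" by (cases a)
  obtain X' cs where "X' \<subseteq> vertices W" "B' = induced W X'" "distinct L'"
    "set L' \<subseteq> set L" "distinct cs" "set cs = set L - set L'" "records_chain n u B' P' (bs @ cs)"
    "\<forall>R. set L \<subseteq> R \<longrightarrow> completable W X R \<longrightarrow> completable W X' (R - set cs)"
    using assms unfolding pass_outcome_def Some a by auto
  then show ?thesis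
    unfolding pass_outcome_def Some a using assms(2)
    by (auto intro!: exI[of _ X'] exI[of _ cs])
qed

lemma singleton_or_several:
  obtains "A = {}" | j where "A = {j}" | j k where "j \<in> A" "k \<in> A" "j \<noteq> k"
  by (metis insertI1 insert_absorb is_singletonI' is_singleton_def)

lemma insert_target_subset:
  "targets (boolean_diagram n w) X i = {j} \<Longrightarrow> X \<subseteq> supp n w \<Longrightarrow> insert j X \<subseteq> supp n w"
  using targetsD[of j "boolean_diagram n w" X i] by auto

lemma forced_pass_outcome:
  assumes "boolean n w" "X \<subseteq> supp n w" "set L \<subseteq> {1..n}" "distinct L"
    "records_chain n u (induced (boolean_diagram n w) X) P bs"
  shows "pass_outcome n u (boolean_diagram n w) X bs L
           (forced_pass n (boolean_diagram n w) (induced (boolean_diagram n w) X) P L)"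
  using assms(2-5)
proof (induction L arbitrary: X P bs)
  case Nil
  then show ?case by (auto simp: pass_outcome_def intro!: exI[of _ X])
next
  case (Cons i L)
  let ?W = "boolean_diagram n w"
  have i: "i \<in> {1..n}" using Cons.prems by simp
  show ?case
  proof (cases rule: singleton_or_several[of "targets ?W X i"])
    case 1
    then show ?thesis
      unfolding forced_pass_none[OF assms(1) Cons.prems(1) i 1] pass_outcome_def
      using completable_no_target[of ?W X _ i] by auto
  next
    case (2 j)
    let ?B' = "induced ?W (insert j X)"
    have jX: "insert j X \<subseteq> supp n w" using insert_target_subset[OF 2 Cons.prems(1)] .
    have "diagram_insertion n (induced ?W X) i ?B'"
      using insertions_below_induced[OF assms(1) Cons.prems(1) i] 2
      by (auto simp: insertions_below_def)
    with Cons.prems(4) have "records_chain n u ?B' (P @ [(induced ?W X, i, ?B')]) (bs @ [i])"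
      by (rule records_chain_snoc)
    with Cons.IH[OF jX] Cons.prems have IH: "pass_outcome n u ?W (insert j X) (bs @ [i]) L
      (forced_pass n ?W ?B' (P @ [(induced ?W X, i, ?B')]) L)" by simp
    show ?thesis
      unfolding forced_pass_forced[OF assms(1) Cons.prems(1) i 2]
    proof (rule pass_outcome_trans[OF _ _ _ _ IH])
      fix R assume "set (i # L) \<subseteq> R" "completable ?W X R"
      then show "completable ?W (insert j X) (R - set [i])"
        using completable_forced[of ?W X R i j] 2 by simp
    qed (use Cons.prems in auto)
  next
    case (3 j k)
    show ?thesis
      unfolding forced_pass_several[OF assms(1) Cons.prems(1) i 3]
      using Cons by (intro pass_outcome_keep) auto
  qed
qed

declare forced_passes.simps [simp del]

lemma forced_passes_outcome:
  assumes "boolean n w" "X \<subseteq> supp n w" "set L \<subseteq> {1..n}" "distinct L"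
    "records_chain n u (induced (boolean_diagram n w) X) P bs"
  shows "pass_outcome n u (boolean_diagram n w) X bs L
           (forced_passes n (boolean_diagram n w) (induced (boolean_diagram n w) X) P L)"
  using assms(2-5)
proof (induction "length L" arbitrary: X P bs L rule: less_induct)
  case less
  let ?W = "boolean_diagram n w"
  let ?r = "forced_pass n ?W (induced ?W X) P L"
  have r: "pass_outcome n u ?W X bs L ?r"
    using assms(1) less.prems by (rule forced_pass_outcome)
  show ?case
  proof (cases "\<exists>B' P' L'. ?r = Some (B', P', L') \<and> length L' < length L")
    case False
    then have "forced_passes n ?W (induced ?W X) P L = ?r"
      by (subst forced_passes.simps) (auto split: option.splits)
    then show ?thesis using r by simp
  next
    case True
    then obtain B' P' L' where L': "?r = Some (B', P', L')" "length L' < length L" by blast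
    obtain X' cs where X': "X' \<subseteq> supp n w" "B' = induced ?W X'" "distinct L'"
      "set L' \<subseteq> set L" "distinct cs" "set cs = set L - set L'" "records_chain n u B' P' (bs @ cs)"
      "\<And>R. set L \<subseteq> R \<Longrightarrow> completable ?W X R \<Longrightarrow> completable ?W X' (R - set cs)"
      using r unfolding pass_outcome_def L' by auto
    have "pass_outcome n u ?W X' (bs @ cs) L' (forced_passes n ?W B' P' L')"
      using less.hyps[of L' X' P' "bs @ cs"] L' X' less.prems by auto
    then have "pass_outcome n u ?W X bs L (forced_passes n ?W B' P' L')"
      using X' by (intro pass_outcome_trans[of L ?W X X' cs L']) auto
    then show ?thesis using L' by (subst forced_passes.simps) simp
  qed
qed

lemma forced_passes_several:
  assumes "forced_passes n W B P L = Some (B', P', L')"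
  shows "\<forall>i \<in> set L'. insertions_below n W B' i \<noteq> {} \<and> \<not> (\<exists>!C. C \<in> insertions_below n W B' i)"
  using assms
proof (induction "length L" arbitrary: B P L rule: less_induct)
  case less
  obtain B1 P1 L1 where r: "forced_pass n W B P L = Some (B1, P1, L1)"
    using less.prems by (subst (asm) forced_passes.simps) (auto split: option.splits)
  show ?case
  proof (cases "length L1 < length L")
    case True
    then show ?thesis using less r by (subst (asm) (2) forced_passes.simps) simp
  next
    case False
    then have "forced_passes n W B P L = Some (B1, P1, L1)"
      using r by (subst forced_passes.simps) simp
    then have e: "B' = B1" "L' = L1" using less.prems by simp_all
    have "length L1 = length L" using forced_pass_length[OF r] False by linarith
    then have "B1 = B" "L1 = L" using forced_pass_length[OF r] by blast+
    with forced_pass_length[OF r] show ?thesis unfolding e by blast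
  qed
qed

section \<open>Monotone paths and the targets on either side\<close>

text \<open>Diagrams are orientations of subgraphs of a path, so directed paths are monotone.\<close>

lemma rtrancl_adjacent:
  assumes "(i, j) \<in> A\<^sup>*" and A: "\<And>a b. (a, b) \<in> A \<Longrightarrow> adjacent a b \<and> (b, a) \<notin> A"
  shows "(i \<le> j \<longrightarrow> (\<forall>k \<in> {i..<j}. (k, Suc k) \<in> A)) \<and> (j \<le> i \<longrightarrow> (\<forall>k \<in> {j..<i}. (Suc k, k) \<in> A))"
  using assms(1)
proof (induction rule: rtrancl_induct)
  case (step y z)
  then consider "z = Suc y" | "y = Suc z" using A by (auto simp: adjacent_def)
  then show ?case
  proof cases
    case 1
    \<comment> \<open>Otherwise the path came down from \<open>Suc y\<close> to \<open>y\<close>,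
      against the arrow from \<open>y\<close> to \<open>z = Suc y\<close>.\<close>
    have "i \<le> y"
    proof (rule ccontr)
      assume "\<not> i \<le> y"
      then have "(z, y) \<in> A" using step.IH 1 by simp
      then show False using A step.hyps(2) by blast
    qed
    then show ?thesis using step 1 by (auto simp: less_Suc_eq)
  next
    case 2
    have "y \<le> i"
    proof (rule ccontr)
      assume "\<not> y \<le> i"
      then have "(z, y) \<in> A" using step.IH 2 by simp
      then show False using A step.hyps(2) by blast
    qed
    then have "\<forall>k \<in> {y..<i}. (Suc k, k) \<in> A" using step.IH by simp
    moreover have "(Suc z, z) \<in> A" using step.hyps(2) 2 by simp
    ultimately have "\<forall>k \<in> {z..<i}. (Suc k, k) \<in> A"
      using 2 by (metis atLeastLessThan_iff le_neq_implies_less not_less_eq_eq not_le)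
    then show ?thesis using 2 \<open>y \<le> i\<close> by simp
  qed
qed simp

lemma rtrancl_ascending:
  assumes "i \<le> j" "\<forall>k \<in> {i..<j}. (k, Suc k) \<in> A"
  shows "(i, j) \<in> A\<^sup>*"
  using assms by (induction rule: dec_induct) (auto intro: rtrancl_into_rtrancl)

lemma rtrancl_descending:
  assumes "j \<le> i" "\<forall>k \<in> {j..<i}. (Suc k, k) \<in> A"
  shows "(i, j) \<in> A\<^sup>*"
  using assms by (induction rule: dec_induct) (auto intro: converse_rtrancl_into_rtrancl)

definition ascends_to :: "diagram \<Rightarrow> nat set \<Rightarrow> nat \<Rightarrow> nat \<Rightarrow> bool" where
  "ascends_to W X i j \<longleftrightarrow> i < j \<and> j \<notin> X \<and> (\<forall>k \<in> {i..<j}. k \<in> X \<and> (k, Suc k) \<in> arrows W)"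

text \<open>For \<open>k\<close> in \<open>{j..<i}\<close> the vertices \<open>Suc k\<close> are j +
  1, ..., i, so the end point \<open>j\<close> is left out.\<close>

definition descends_to :: "diagram \<Rightarrow> nat set \<Rightarrow> nat \<Rightarrow> nat \<Rightarrow> bool" where
  "descends_to W X i j \<longleftrightarrow> j < i \<and> j \<notin> X \<and> (\<forall>k \<in> {j..<i}. Suc k \<in> X \<and> (Suc k, k) \<in> arrows W)"

lemma arrows_asym:
  "boolean n w \<Longrightarrow> (a, b) \<in> arrows (boolean_diagram n w) \<Longrightarrow>
     adjacent a b \<and> (b, a) \<notin> arrows (boolean_diagram n w)"
  using arrow_orientation arrows_boolean_diagramD by meson

text \<open>By monotonicity only one upward and one downward path start in \<open>i\<close>, and
  each can only end at the first missing vertex. Hence there is at most one target on each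
  side.\<close>

lemma targets_iff:
  assumes w: "boolean n w" and i: "i \<in> X"
  shows "j \<in> targets (boolean_diagram n w) X i \<longleftrightarrow>
    ascends_to (boolean_diagram n w) X i j \<or> descends_to (boolean_diagram n w) X i j"
proof
  let ?W = "boolean_diagram n w"
  let ?A = "arrows (induced ?W (insert j X))"
  assume j: "j \<in> targets ?W X i"
  then have r: "(i, j) \<in> ?A\<^sup>*" "j \<notin> X" using i by (auto simp: targets_def)
  have *: "(i \<le> j \<longrightarrow> (\<forall>k \<in> {i..<j}. (k, Suc k) \<in> ?A)) \<and> (j \<le> i \<longrightarrow> (\<forall>k \<in> {j..<i}. (Suc k, k) \<in> ?A))"
    by (rule rtrancl_adjacent[OF r(1)]) (use arrows_asym[OF w] in \<open>auto simp: induced_def\<close>)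
  have "i \<noteq> j" using i r by auto
  then consider "i < j" | "j < i" by linarith
  then show "ascends_to ?W X i j \<or> descends_to ?W X i j"
  proof cases
    case 1
    then show ?thesis using * r(2) by (auto simp: ascends_to_def induced_def)
  next
    case 2
    then show ?thesis using * r(2) by (auto simp: descends_to_def induced_def)
  qed
next
  let ?W = "boolean_diagram n w"
  let ?A = "arrows (induced ?W (insert j X))"
  assume "ascends_to ?W X i j \<or> descends_to ?W X i j"
  then show "j \<in> targets ?W X i"
  proof
    assume a: "ascends_to ?W X i j"
    then have "(j - 1, j) \<in> arrows ?W"
      by (cases j) (auto simp: ascends_to_def)
    then have "j \<in> supp n w" using arrows_boolean_diagramD by blast
    moreover have "(i, j) \<in> ?A\<^sup>*"
    proof (rule rtrancl_ascending)
      show "\<forall>k \<in> {i..<j}. (k, Suc k) \<in> ?A"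
      proof
        fix k assume k: "k \<in> {i..<j}"
        then have "Suc k = j \<or> Suc k \<in> {i..<j}" by auto
        then show "(k, Suc k) \<in> ?A" using a k by (auto simp: ascends_to_def induced_def)
      qed
    qed (use a in \<open>simp add: ascends_to_def\<close>)
    ultimately show ?thesis using a i by (simp add: targets_def ascends_to_def)
  next
    assume a: "descends_to ?W X i j"
    then have "(Suc j, j) \<in> arrows ?W" by (auto simp: descends_to_def)
    then have "j \<in> supp n w" using arrows_boolean_diagramD by blast
    moreover have "(i, j) \<in> ?A\<^sup>*"
    proof (rule rtrancl_descending)
      show "\<forall>k \<in> {j..<i}. (Suc k, k) \<in> ?A"
      proof
        fix k assume k: "k \<in> {j..<i}"
        then have "k = j \<or> k - 1 \<in> {j..<i} \<and> Suc (k - 1) = k" by auto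
        then have "k \<in> insert j X" using a unfolding descends_to_def by (metis insertCI)
        then show "(Suc k, k) \<in> ?A" using a k by (auto simp: descends_to_def induced_def)
      qed
    qed (use a in \<open>simp add: descends_to_def\<close>)
    ultimately show ?thesis using a i by (simp add: targets_def descends_to_def)
  qed
qed

lemma ascends_to_unique: "ascends_to W X i j \<Longrightarrow> ascends_to W X i k \<Longrightarrow> j = k"
  by (rule linorder_cases[of j k]) (auto simp: ascends_to_def)

lemma descends_to_unique:
  assumes "descends_to W X i j" "descends_to W X i k"
  shows "j = k"
proof -
  have False if "descends_to W X i j" "descends_to W X i k" "j < k" for j k
  proof -
    have "k - 1 \<in> {j..<i}" "Suc (k - 1) = k" using that by (auto simp: descends_to_def)
    then show False using that unfolding descends_to_def by metis
  qed
  with assms show ?thesis by (metis linorder_neqE_nat)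
qed

lemma two_targets:
  assumes "boolean n w" "j \<in> targets (boolean_diagram n w) X i"
    "k \<in> targets (boolean_diagram n w) X i" "j \<noteq> k"
  shows "\<exists>p q. ascends_to (boolean_diagram n w) X i p \<and> descends_to (boolean_diagram n w) X i q"
proof -
  have "i \<in> X" using assms by (auto simp: targets_def split: if_splits)
  then show ?thesis
    using assms targets_iff[OF assms(1)] ascends_to_unique descends_to_unique by metis
qed

text \<open>The elements of \<open>S\<close> are sources of \<open>W\<close>, so that between two of them there is a missing
  vertex, and there is one more below and one more above all of them.\<close>

lemma card_several_targets:
  assumes w: "boolean n w" and "finite S" "S \<noteq> {}"
    and S: "\<And>i. i \<in> S \<Longrightarrow> \<exists>j k. j \<in> targets (boolean_diagram n w) X i \<and>
                                k \<in> targets (boolean_diagram n w) X i \<and> j \<noteq> k"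
  shows "card S < card (supp n w - X)"
proof -
  let ?W = "boolean_diagram n w"
  have "\<forall>i \<in> S. \<exists>p q. ascends_to ?W X i p \<and> descends_to ?W X i q"
    using S two_targets[OF w] by blast
  then obtain p q where p: "\<And>i. i \<in> S \<Longrightarrow> ascends_to ?W X i (p i)"
    and q: "\<And>i. i \<in> S \<Longrightarrow> descends_to ?W X i (q i)" by metis
  \<comment> \<open>A common missing vertex above \<open>i < i'\<close> puts the arrow from
    \<open>i' - 1\<close> to \<open>i'\<close> on the path of \<open>i\<close>, whereas
    \<open>i'\<close> descends along the opposite arrow.\<close>
  have ne: "p i \<noteq> p i'" if "i \<in> S" "i' \<in> S" "i < i'" for i i'
  proof
    assume e: "p i = p i'"
    have "i' < p i'" using p[OF that(2)] by (simp add: ascends_to_def)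
    then have "i' - 1 \<in> {i..<p i}" "Suc (i' - 1) = i'" using that e by auto
    then have "(i' - 1, i') \<in> arrows ?W" using p[OF that(1)] unfolding ascends_to_def by metis
    moreover have "i' - 1 \<in> {q i'..<i'}" using q[OF that(2)] by (auto simp: descends_to_def)
    then have "(i', i' - 1) \<in> arrows ?W"
      using q[OF that(2)] \<open>Suc (i' - 1) = i'\<close> unfolding descends_to_def by metis
    ultimately show False using arrows_asym[OF w] by blast
  qed
  then have "inj_on p S" by (intro inj_onI) (metis linorder_neqE_nat)
  then have "card S = card (p ` S)" by (simp add: card_image)
  also have "\<dots> < card (supp n w - X)"
  proof (rule psubset_card_mono)
    have iX: "i \<in> X" if "i \<in> S" for i using p[OF that] by (auto simp: ascends_to_def)
    have pq: "p i \<in> supp n w - X" "q i \<in> supp n w - X" if "i \<in> S" for i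
      using targets_iff[OF w iX[OF that]] p[OF that] q[OF that] targetsD[of _ ?W X i] by auto
    \<comment> \<open>The missing vertex below the smallest source lies below every
      \<open>p i\<close>; it makes the inequality strict.\<close>
    let ?m = "Min S"
    have m: "?m \<in> S" using assms(2,3) by simp
    have "q ?m \<notin> p ` S"
    proof
      assume "q ?m \<in> p ` S"
      then obtain i where i: "i \<in> S" "q ?m = p i" by blast
      have "q ?m < ?m" using q[OF m] by (simp add: descends_to_def)
      also have "?m \<le> i" using assms(2) i by simp
      also have "i < p i" using p[OF i(1)] by (simp add: ascends_to_def)
      finally show False using i by simp
    qed
    then show "p ` S \<subset> supp n w - X" using pq m by blast
  qed simp
  finally show ?thesis .
qed

section \<open>Step (5) and the correctness of the result\<close>

lemma matched_insertions_length:
  "length I \<noteq> length J \<Longrightarrow> matched_insertions n W B P I J = None"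
  by (induction n W B P I J rule: matched_insertions.induct) (auto simp: Let_def)

text \<open>The situation in which step (5) begins. By the last conclusion its two lists have equal
  length only if both are empty.\<close>

lemma forced_passes_result:
  assumes "boolean n u" "boolean n w" "subdiagram (boolean_diagram n u) (boolean_diagram n w)"
    "boolean n v"
    "forced_passes n (boolean_diagram n w) (boolean_diagram n u) []
       (sorted_list_of_set (supp n v)) = Some (B, P, L)"
  obtains X cs where "X \<subseteq> supp n w" "B = induced (boolean_diagram n w) X"
    "distinct L" "set L \<subseteq> supp n v" "distinct cs" "set cs = supp n v - set L"
    "records_chain n u B P cs"
    "completable (boolean_diagram n w) (supp n u) (supp n v) \<Longrightarrow>
       completable (boolean_diagram n w) X (set L)"
    "L \<noteq> [] \<Longrightarrow> length L < card (supp n w - X)"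
proof -
  let ?W = "boolean_diagram n w"
  let ?L = "sorted_list_of_set (supp n v)"
  have r: "boolean_diagram n u = induced ?W (supp n u)" using eq_inducedI[OF assms(1-3)] .
  have "pass_outcome n u ?W (supp n u) [] ?L
      (forced_passes n ?W (induced ?W (supp n u)) [] ?L)"
    using assms(1-3) records_chain_Nil[OF assms(1)] r supp_subset
    by (intro forced_passes_outcome) (auto simp: subdiagram_def)
  then obtain X cs where X: "X \<subseteq> supp n w" "B = induced ?W X" "distinct L" "set L \<subseteq> supp n v"
    "distinct cs" "set cs = supp n v - set L" "records_chain n u B P cs"
    and c: "\<And>R. supp n v \<subseteq> R \<Longrightarrow> completable ?W (supp n u) R \<Longrightarrow> completable ?W X (R - set cs)"
    unfolding r[symmetric] assms(5) by (auto simp: pass_outcome_def)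
  have "completable ?W X (set L)" if "completable ?W (supp n u) (supp n v)"
  proof -
    have "supp n v - set cs = set L" using X(4,6) by blast
    with c[OF _ that] show ?thesis by simp
  qed
  moreover have "length L < card (supp n w - X)" if "L \<noteq> []"
  proof -
    have "card (set L) < card (supp n w - X)"
    proof (rule card_several_targets[OF assms(2)])
      fix i assume i: "i \<in> set L"
      then have "i \<in> {1..n}" using X(4) supp_subset by blast
      then have "insertions_below n ?W B i = (\<lambda>j. induced ?W (insert j X)) ` targets ?W X i"
        unfolding X(2) by (rule insertions_below_induced[OF assms(2) X(1)])
      moreover have "insertions_below n ?W B i \<noteq> {}"
        "\<not> (\<exists>!C. C \<in> insertions_below n ?W B i)"
        using forced_passes_several[OF assms(5)] i by blast+
      ultimately have "targets ?W X i \<noteq> {}" "targets ?W X i \<noteq> {j}" for j by force+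
      then show "\<exists>j k. j \<in> targets ?W X i \<and> k \<in> targets ?W X i \<and> j \<noteq> k"
        using singleton_or_several by metis
    qed (use that in auto)
    then show ?thesis using X(3) by (simp add: distinct_card)
  qed
  ultimately show ?thesis using X that by blast
qed

lemma insertion_algorithm_correct:
  assumes u: "boolean n u" and v: "boolean n v" and w: "boolean n w"
  shows "case insertion_algorithm n (boolean_diagram n u) (boolean_diagram n v) (boolean_diagram n w) of
           Some P \<Rightarrow> (\<exists>us bs. boolean_insertion_path n u v w us bs \<and> P = path_steps n us bs)
         | None \<Rightarrow> \<not> (\<exists>us bs. boolean_insertion_path n u v w us bs)"
proof -
  let ?U = "boolean_diagram n u" and ?V = "boolean_diagram n v" and ?W = "boolean_diagram n w"
  let ?passes = "forced_passes n ?W ?U [] (sorted_list_of_set (supp n v))"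
  have path: "subdiagram ?U ?W \<and> completable ?W (supp n u) (supp n v)"
    if "boolean_insertion_path n u v w us bs" for us bs
    using completable_insertion_chain[of n us bs w] that w unfolding boolean_insertion_path_iff by auto
  show ?thesis
  proof (cases "subdiagram ?U ?W")
    case False
    then show ?thesis using path by (auto simp: insertion_algorithm_def)
  next
    case sub: True
    have r: "?U = induced ?W (supp n u)" using eq_inducedI[OF u w sub] .
    show ?thesis
    proof (cases ?passes)
      case None
      have "pass_outcome n u ?W (supp n u) [] (sorted_list_of_set (supp n v))
          (forced_passes n ?W (induced ?W (supp n u)) [] (sorted_list_of_set (supp n v)))"
        using w sub records_chain_Nil[OF u] r supp_subset
        by (intro forced_passes_outcome) (auto simp: subdiagram_def)
      then have "\<not> completable ?W (supp n u) (supp n v)"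
        unfolding r[symmetric] None by (simp add: pass_outcome_def)
      then show ?thesis using path sub None by (auto simp: insertion_algorithm_def)
    next
      case (Some a)
      obtain B P L where a: "a = (B, P, L)" by (cases a)
      from Some a have p: "?passes = Some (B, P, L)" by simp
      from forced_passes_result[OF u w sub v p] obtain X cs where
        X: "X \<subseteq> supp n w" "B = induced ?W X" "distinct L" "set L \<subseteq> supp n v" "distinct cs"
          "set cs = supp n v - set L" "records_chain n u B P cs"
        and c: "completable ?W (supp n u) (supp n v) \<Longrightarrow> completable ?W X (set L)"
        and l: "L \<noteq> [] \<Longrightarrow> length L < card (supp n w - X)" by blast
      let ?J = "sorted_list_of_set (supp n w - X)"
      have alg: "insertion_algorithm n ?U ?V ?W = matched_insertions n ?W B P L ?J"
        using sub p X(2) by (simp add: insertion_algorithm_def)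
      show ?thesis
      proof (cases "length L = length ?J")
        case True
        then have L: "L = []" using l by fastforce
        with True have "X = supp n w" using X(1) by auto
        then have B: "B = ?W" using X(2) by simp
        obtain us where us: "insertion_chain n us cs" "us ! 0 = u" "boolean n (us ! length cs)"
          "boolean_diagram n (us ! length cs) = B" "P = path_steps n us cs"
          using X(7) by (auto simp: records_chain_def)
        have "us ! length cs = w" using inj_boolean_diagram[OF us(3) w] us(4) B by simp
        then have "boolean_insertion_path n u v w us cs"
          unfolding boolean_insertion_path_iff using us X(5,6) L by simp
        moreover have "insertion_algorithm n ?U ?V ?W = Some P"
          using alg L \<open>X = supp n w\<close> by simp
        ultimately show ?thesis using us(5) by auto
      next
        case False
        \<comment> \<open>A completion would use exactly one index per missing vertex.\<close>
        have "\<not> completable ?W (supp n u) (supp n v)"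
        proof
          assume "completable ?W (supp n u) (supp n v)"
          from completable_card[OF c[OF this]] have "card (set L) = card (supp n w - X)" by simp
          then show False using False X(3) by (simp add: distinct_card)
        qed
        then show ?thesis using alg False path by (auto simp: matched_insertions_length)
      qed
    qed
  qed
qed

section \<open>Results of the counted procedures\<close>

lemma val_bind_tm [simp]: "val (bind_tm m f) = val (f (val m))"
  by simp

lemma time_bind_tm [simp]: "time (bind_tm m f) = time m + time (f (val m))"
  by simp

lemma val_return [simp]: "val (return x) = x" and time_return [simp]: "time (return x) = 0"
  by (simp_all add: return_def)

lemma time_tick [simp]: "time (tick t) = t"
  by (simp add: tick_def)

declare bind_tm.simps [simp del] scan_up_tm.simps [simp del]

lemma val_primitives [simp]:
  "val (has_vertex B k) \<longleftrightarrow> k \<in> vertices B"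
  "val (has_arrow B k j) \<longleftrightarrow> (k, j) \<in> arrows B"
  "val (add_vertex k B) = (insert k (vertices B), arrows B)"
  "val (add_arrow k j B) = (vertices B, insert (k, j) (arrows B))"
  "val (copy_diagram n B) = B"
  "val (length_tm xs) = length xs"
  "val (member_tm x xs) \<longleftrightarrow> x \<in> set xs"
  "val (rev_tm xs) = rev xs"
  by (simp_all add: has_vertex_def has_arrow_def add_vertex_def add_arrow_def copy_diagram_def
      length_tm_def member_tm_def rev_tm_def)

lemma time_primitives [simp]:
  "time (has_vertex B k) = 1"
  "time (has_arrow B k j) = 1"
  "time (add_vertex k B) = 1"
  "time (add_arrow k j B) = 1"
  "time (copy_diagram n B) = 3 * n"
  "time (length_tm xs) = length xs + 1"
  "time (member_tm x xs) = length xs + 1"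
  "time (rev_tm xs) = length xs + 1"
  by (simp_all add: has_vertex_def has_arrow_def add_vertex_def add_arrow_def copy_diagram_def
      length_tm_def member_tm_def rev_tm_def)

lemma val_subdiagram_tm:
  "val (subdiagram_tm n B C) \<longleftrightarrow> (\<forall>k \<in> {1..n}. (k \<in> vertices B \<longrightarrow> k \<in> vertices C) \<and>
     ((k, Suc k) \<in> arrows B \<longrightarrow> (k, Suc k) \<in> arrows C) \<and>
     ((Suc k, k) \<in> arrows B \<longrightarrow> (Suc k, k) \<in> arrows C))"
proof (induction n B C rule: subdiagram_tm.induct)
  case (2 k B C)
  have "{1..Suc k} = insert (Suc k) {1..k}" by auto
  with 2 show ?case by auto
qed simp

text \<open>Reading the bits for 1, ..., n suffices: supports lie in \<open>{1..n}\<close> and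
  arrows join neighbours.\<close>

lemma subdiagram_tm_eq:
  "val (subdiagram_tm n (boolean_diagram n u) (boolean_diagram n w)) \<longleftrightarrow>
     subdiagram (boolean_diagram n u) (boolean_diagram n w)"
proof
  assume "subdiagram (boolean_diagram n u) (boolean_diagram n w)"
  then show "val (subdiagram_tm n (boolean_diagram n u) (boolean_diagram n w))"
    unfolding val_subdiagram_tm subdiagram_def by blast
next
  assume v: "val (subdiagram_tm n (boolean_diagram n u) (boolean_diagram n w))"
  have "supp n u \<subseteq> supp n w"
    using v supp_subset[of n u] unfolding val_subdiagram_tm by auto
  moreover have "e \<in> arrows (boolean_diagram n w)" if e: "e \<in> arrows (boolean_diagram n u)" for e
  proof -
    obtain a b where ab: "e = (a, b)" by fastforce
    with e have "a \<in> {1..n}" "b \<in> {1..n}" "adjacent a b"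
      using arrows_boolean_diagramD[of a b n u] supp_subset[of n u] by blast+
    then show ?thesis using v e unfolding val_subdiagram_tm ab adjacent_def by blast
  qed
  ultimately show "subdiagram (boolean_diagram n u) (boolean_diagram n w)"
    by (auto simp: subdiagram_def)
qed

lemma val_vertex_list_tm:
  "val (vertex_list_tm n V acc) = filter (\<lambda>k. k \<in> vertices V) [1..<Suc n] @ acc"
  by (induction n V acc rule: vertex_list_tm.induct) auto

lemma val_missing_list_tm:
  "val (missing_list_tm n W B acc) =
     filter (\<lambda>k. k \<in> vertices W \<and> k \<notin> vertices B) [1..<Suc n] @ acc"
  by (induction n W B acc rule: missing_list_tm.induct) auto

lemma filter_upt_eq: "A \<subseteq> {1..n} \<Longrightarrow> filter (\<lambda>k. k \<in> A) [1..<Suc n] = sorted_list_of_set A"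
proof -
  assume A: "A \<subseteq> {1..n}"
  let ?xs = "filter (\<lambda>k. k \<in> A) [1..<Suc n]"
  have "set ?xs = A" using A by auto
  moreover have "sorted_list_of_set (set ?xs) = ?xs"
    by (intro sorted_list_of_set.idem_if_sorted_distinct) (auto intro: sorted_wrt_filter simp del: upt_Suc)
  ultimately show ?thesis by metis
qed

section \<open>Scans compute the targets\<close>

lemma ascends_to_rec:
  "ascends_to W X i j \<longleftrightarrow> i \<in> X \<and> (i, Suc i) \<in> arrows W \<and>
     (j = Suc i \<and> Suc i \<notin> X \<or> Suc i \<in> X \<and> ascends_to W X (Suc i) j)"
proof (cases "Suc i < j")
  case True
  then have "{i..<j} = insert i {Suc i..<j}" by auto
  with True show ?thesis by (auto simp: ascends_to_def)
next
  case False
  then have "i < j \<longleftrightarrow> j = Suc i" by auto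
  with False show ?thesis by (auto simp: ascends_to_def)
qed

lemma descends_to_rec:
  "descends_to W X (Suc i) j \<longleftrightarrow> Suc i \<in> X \<and> (Suc i, i) \<in> arrows W \<and>
     (j = i \<and> i \<notin> X \<or> i \<in> X \<and> descends_to W X i j)"
proof (cases "j < i")
  case True
  then have "{j..<Suc i} = insert i {j..<i}" "i - 1 \<in> {j..<i}" "Suc (i - 1) = i" by auto
  with True show ?thesis unfolding descends_to_def by (metis insert_iff less_SucI less_irrefl)
next
  case False
  show ?thesis
  proof (cases "j = i")
    case True
    then have "{j..<Suc i} = {i}" by auto
    with True show ?thesis by (auto simp: descends_to_def)
  next
    case False
    with \<open>\<not> j < i\<close> show ?thesis by (auto simp: descends_to_def)
  qed
qed

text \<open>No upward arrow starts at or beyond \<open>n\<close>, so the stop at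
  \<open>n \<le> k\<close> loses no target.\<close>

lemma val_scan_up_tm:
  assumes "\<And>k. n \<le> k \<Longrightarrow> (k, Suc k) \<notin> arrows W" "i \<in> vertices B"
  shows "set (val (scan_up_tm n W B i)) = {j. ascends_to W (vertices B) i j} \<and>
         length (val (scan_up_tm n W B i)) \<le> 1"
  using assms
proof (induction n W B i rule: scan_up_tm.induct)
  case (1 n W B k)
  show ?case
  proof (cases "n \<le> k \<or> (k, Suc k) \<notin> arrows W \<or> Suc k \<notin> vertices B")
    case True
    then show ?thesis using 1(2,3)
      by (auto simp: scan_up_tm.simps[of n W B k] ascends_to_rec[of W _ k])
  next
    case False
    then have "set (val (scan_up_tm n W B (Suc k))) = {j. ascends_to W (vertices B) (Suc k) j} \<and>
         length (val (scan_up_tm n W B (Suc k))) \<le> 1"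
      using 1 by simp
    then show ?thesis using False 1(3)
      by (auto simp: scan_up_tm.simps[of n W B k] ascends_to_rec[of W _ k])
  qed
qed

lemma val_scan_down_tm:
  assumes "i \<in> vertices B"
  shows "set (val (scan_down_tm W B i)) = {j. descends_to W (vertices B) i j} \<and>
         length (val (scan_down_tm W B i)) \<le> 1"
  using assms
proof (induction W B i rule: scan_down_tm.induct)
  case (1 W B)
  then show ?case by (simp add: descends_to_def)
next
  case (2 W B k)
  then show ?case by (auto simp: descends_to_rec)
qed

lemma distinct_length_le_1: "length xs \<le> Suc 0 \<Longrightarrow> distinct xs"
  by (cases xs) auto

text \<open>Distinctness makes the length of the list the number of targets, so the case distinction
  in \<open>forced_pass_tm\<close> agrees with the uniqueness test in
  \<open>forced_pass\<close>.\<close>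

lemma val_targets_tm:
  assumes "boolean n w"
  shows "set (val (targets_tm n (boolean_diagram n w) (induced (boolean_diagram n w) X) i)) =
           targets (boolean_diagram n w) X i \<and>
         distinct (val (targets_tm n (boolean_diagram n w) (induced (boolean_diagram n w) X) i))"
proof (cases "i \<in> X")
  case True
  let ?W = "boolean_diagram n w"
  have "(k, Suc k) \<notin> arrows ?W" if "n \<le> k" for k
    using arrows_boolean_diagramD[of k "Suc k" n w] supp_subset[of n w] that by auto
  then have "set (val (scan_up_tm n ?W (induced ?W X) i)) = {j. ascends_to ?W X i j} \<and>
         length (val (scan_up_tm n ?W (induced ?W X) i)) \<le> 1"
    using val_scan_up_tm[of n ?W i "induced ?W X"] True by simp
  moreover have "set (val (scan_down_tm ?W (induced ?W X) i)) = {j. descends_to ?W X i j} \<and>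
         length (val (scan_down_tm ?W (induced ?W X) i)) \<le> 1"
    using val_scan_down_tm[of i "induced ?W X" ?W] True by simp
  moreover have "\<not> (ascends_to ?W X i j \<and> descends_to ?W X i j)" for j
    by (auto simp: ascends_to_def descends_to_def)
  ultimately show ?thesis
    using True targets_iff[OF assms True] by (auto simp: targets_tm_def distinct_length_le_1)
next
  case False
  then show ?thesis by (simp add: targets_tm_def) (simp add: targets_def)
qed

text \<open>Between adjacent vertices B(w) has exactly one of the two arrows, so reading one bit
  decides which of them to add.\<close>

lemma val_link_tm:
  assumes "boolean n w" "vertices B \<subseteq> supp n w" "j \<in> vertices B" "adjacent j k"
  shows "val (link_tm (boolean_diagram n w) j k B) =
    (vertices B, arrows B \<union> (arrows (boolean_diagram n w) \<inter> {(j, k), (k, j)} \<inter> UNIV \<times> vertices B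
       \<inter> vertices B \<times> UNIV))"
proof (cases "k \<in> vertices B")
  case True
  then have "(j, k) \<in> arrows (boolean_diagram n w) \<longleftrightarrow> (k, j) \<notin> arrows (boolean_diagram n w)"
    using arrow_orientation[OF assms(1) _ _ assms(4)] assms(2,3) by blast
  then show ?thesis using True assms(3) by (auto simp: link_tm_def)
next
  case False
  then show ?thesis by (cases B) (auto simp: link_tm_def)
qed

lemma val_perform_tm:
  assumes w: "boolean n w" and X: "insert j X \<subseteq> supp n w" and j: "j \<notin> X"
  shows "val (perform_tm n (boolean_diagram n w) (induced (boolean_diagram n w) X) i j P) =
    (induced (boolean_diagram n w) (insert j X),
     (induced (boolean_diagram n w) X, i, induced (boolean_diagram n w) (insert j X)) # P)"
proof -
  let ?W = "boolean_diagram n w"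
  \<comment> \<open>For \<open>j = 0\<close> the truncated \<open>j - 1\<close> would be
    \<open>j\<close> itself and no neighbour.\<close>
  have "1 \<le> j" using X supp_subset[of n w] by auto
  then have adj: "adjacent j (j - 1)" "adjacent j (j + 1)" by (auto simp: adjacent_def)
  have link: "val (link_tm ?W j k (insert j X, Y)) =
      (insert j X, Y \<union> (arrows ?W \<inter> {(j, k), (k, j)} \<inter> UNIV \<times> insert j X \<inter> insert j X \<times> UNIV))"
    if "adjacent j k" for k Y
    using val_link_tm[OF w _ _ that, of "(insert j X, Y)"] X by simp
  have "a = j \<and> (b = j - 1 \<or> b = j + 1) \<or> b = j \<and> (a = j - 1 \<or> a = j + 1) \<or> a \<in> X \<and> b \<in> X"
    if "(a, b) \<in> arrows ?W" "a \<in> insert j X" "b \<in> insert j X" for a b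
    using arrows_boolean_diagramD[OF that(1)] that by (auto simp: adjacent_def)
  then have "(insert j X, (arrows (induced ?W X) \<union>
      (arrows ?W \<inter> {(j, j - 1), (j - 1, j)} \<inter> UNIV \<times> insert j X \<inter> insert j X \<times> UNIV)) \<union>
      (arrows ?W \<inter> {(j, j + 1), (j + 1, j)} \<inter> UNIV \<times> insert j X \<inter> insert j X \<times> UNIV)) =
    induced ?W (insert j X)"
    by (auto simp: induced_def)
  then show ?thesis
    unfolding perform_tm_def val_bind_tm val_primitives vertices_induced link[OF adj(1)] link[OF adj(2)]
    by simp
qed

lemma val_forced_pass_tm:
  assumes w: "boolean n w" and "X \<subseteq> supp n w" "set L \<subseteq> {1..n}"
  shows "val (forced_pass_tm n (boolean_diagram n w) (induced (boolean_diagram n w) X) P L) =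
    map_option (\<lambda>(B, P, L). (B, rev P, L))
      (forced_pass n (boolean_diagram n w) (induced (boolean_diagram n w) X) (rev P) L)"
  using assms(2,3)
proof (induction L arbitrary: X P)
  case (Cons i L)
  let ?W = "boolean_diagram n w"
  let ?js = "val (targets_tm n ?W (induced ?W X) i)"
  have js: "set ?js = targets ?W X i" "distinct ?js" using val_targets_tm[OF w] by auto
  have i: "i \<in> {1..n}" and L: "set L \<subseteq> {1..n}" using Cons.prems by auto
  consider "?js = []" | j where "?js = [j]" | j k ls where "?js = j # k # ls"
    by (metis neq_Nil_conv)
  then show ?case
  proof cases
    case 1
    then have "targets ?W X i = {}" using js by simp
    with 1 show ?thesis
      using forced_pass_none[OF w Cons.prems(1) i] by (simp del: forced_pass.simps)
  next
    case (2 j)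
    then have t: "targets ?W X i = {j}" using js by simp
    have jX: "insert j X \<subseteq> supp n w" "j \<notin> X"
      using insert_target_subset[OF t Cons.prems(1)] targetsD[of j ?W X i] t by auto
    show ?thesis
      unfolding forced_pass_forced[OF w Cons.prems(1) i t]
      using 2 Cons.IH[OF jX(1) L, of "(induced ?W X, i, induced ?W (insert j X)) # P"]
      by (simp add: val_perform_tm[OF w jX])
  next
    case (3 j k ls)
    then have t: "j \<in> targets ?W X i" "k \<in> targets ?W X i" "j \<noteq> k" using js by auto
    show ?thesis
      unfolding forced_pass_several[OF w Cons.prems(1) i t]
      using 3 Cons.IH[OF Cons.prems(1) L, of P] by (auto split: option.splits)
  qed
qed simp

declare forced_passes_tm.simps [simp del]

text \<open>The record of a chain gives access to \<open>forced_pass_outcome\<close>, by which each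
  pass leaves an induced diagram again, so that the comparison can be repeated.\<close>

lemma val_forced_passes_tm:
  assumes w: "boolean n w" and "X \<subseteq> supp n w" "set L \<subseteq> {1..n}" "distinct L"
    "records_chain n u (induced (boolean_diagram n w) X) (rev P) bs"
  shows "val (forced_passes_tm n (boolean_diagram n w) (induced (boolean_diagram n w) X) P L) =
    map_option (\<lambda>(B, P, L). (B, rev P, L))
      (forced_passes n (boolean_diagram n w) (induced (boolean_diagram n w) X) (rev P) L)"
  using assms(2-5)
proof (induction "length L" arbitrary: X P L bs rule: less_induct)
  case less
  let ?W = "boolean_diagram n w"
  let ?r = "forced_pass n ?W (induced ?W X) (rev P) L"
  note r = val_forced_pass_tm[OF w less.prems(1,2), of P]
  show ?case
  proof (cases "\<exists>B' P' L'. ?r = Some (B', P', L') \<and> length L' < length L")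
    case False
    then show ?thesis
      by (subst forced_passes_tm.simps, subst forced_passes.simps)
        (auto simp: r split: option.splits)
  next
    case True
    then obtain B' P' L' where L': "?r = Some (B', P', L')" "length L' < length L" by blast
    have "pass_outcome n u ?W X bs L ?r"
      using w less.prems by (rule forced_pass_outcome)
    then obtain X' cs where X': "X' \<subseteq> supp n w" "B' = induced ?W X'" "distinct L'"
      "set L' \<subseteq> set L" "records_chain n u B' P' (bs @ cs)"
      unfolding pass_outcome_def L' by auto
    then have "val (forced_passes_tm n ?W B' (rev P') L') =
      map_option (\<lambda>(B, P, L). (B, rev P, L)) (forced_passes n ?W B' P' L')"
      using less.hyps[of L' X' "rev P'" "bs @ cs"] L' less.prems by auto
    then show ?thesis using L'
      by (subst forced_passes_tm.simps, subst forced_passes.simps) (simp add: r)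
  qed
qed

lemma val_matched_insertions_tm_length:
  "length I \<noteq> length J \<Longrightarrow> val (matched_insertions_tm n W B P I J) = None"
  by (induction n W B P I J rule: matched_insertions_tm.induct) auto

lemma insertion_algorithm_tm_val:
  assumes u: "boolean n u" and v: "boolean n v" and w: "boolean n w"
  shows "val (insertion_algorithm_tm n (boolean_diagram n u) (boolean_diagram n v) (boolean_diagram n w)) =
    insertion_algorithm n (boolean_diagram n u) (boolean_diagram n v) (boolean_diagram n w)"
proof (cases "subdiagram (boolean_diagram n u) (boolean_diagram n w)")
  case False
  then show ?thesis
    by (simp add: insertion_algorithm_tm_def insertion_algorithm_def subdiagram_tm_eq)
next
  case sub: True
  let ?U = "boolean_diagram n u" and ?V = "boolean_diagram n v" and ?W = "boolean_diagram n w"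
  let ?S = "sorted_list_of_set (supp n v)"
  have S: "val (vertex_list_tm n ?V []) = ?S"
    using filter_upt_eq[OF supp_subset] by (simp add: val_vertex_list_tm)
  have r: "?U = induced ?W (supp n u)" using eq_inducedI[OF u w sub] .
  have "val (forced_passes_tm n ?W (induced ?W (supp n u)) [] ?S) =
    map_option (\<lambda>(B, P, L). (B, rev P, L)) (forced_passes n ?W (induced ?W (supp n u)) (rev []) ?S)"
    using w sub records_chain_Nil[OF u] r supp_subset
    by (intro val_forced_passes_tm[where u = u and bs = "[]"]) (auto simp: subdiagram_def)
  then have f: "val (forced_passes_tm n ?W ?U [] ?S) =
    map_option (\<lambda>(B, P, L). (B, rev P, L)) (forced_passes n ?W ?U [] ?S)"
    by (simp add: r[symmetric])
  show ?thesis
  proof (cases "forced_passes n ?W ?U [] ?S")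
    case None
    then show ?thesis using sub
      by (simp add: insertion_algorithm_tm_def insertion_algorithm_def subdiagram_tm_eq S f)
  next
    case (Some a)
    obtain B P L where a: "a = (B, P, L)" by (cases a)
    from Some a have p: "forced_passes n ?W ?U [] ?S = Some (B, P, L)" by simp
    from forced_passes_result[OF u w sub v p] obtain X where
      X: "B = induced ?W X" and l: "L \<noteq> [] \<Longrightarrow> length L < card (supp n w - X)" by blast
    let ?J = "sorted_list_of_set (supp n w - X)"
    have J: "val (missing_list_tm n ?W B []) = ?J"
      using filter_upt_eq[of "supp n w - X" n] supp_subset[of n w]
      by (simp add: val_missing_list_tm X le_infI1 Diff_eq del: upt_Suc)
    \<comment> \<open>By \<open>l\<close>, either both lists are empty or their lengths differ; in
      the second case both versions return \<open>None\<close>.\<close>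
    have "val (matched_insertions_tm n ?W B (rev P) L ?J) = matched_insertions n ?W B P L ?J"
    proof (cases "length L = length ?J")
      case True
      then have L: "L = []" using l by fastforce
      then have J': "?J = []" using True by (metis length_0_conv)
      show ?thesis unfolding J' L by simp
    qed (simp add: matched_insertions_length val_matched_insertions_tm_length)
    then show ?thesis using sub
      by (simp add: insertion_algorithm_tm_def insertion_algorithm_def subdiagram_tm_eq S f p J) (simp add: X)
  qed
qed

section \<open>Running time\<close>

text \<open>An element \<open>k\<close> stands for the arrow from \<open>k\<close> to
  \<open>Suc k\<close>. The set depends on W alone, so it bounds the scan from \<open>i\<close>
  whatever the current diagram is.\<close>

definition ascent :: "nat \<Rightarrow> diagram \<Rightarrow> nat \<Rightarrow> nat set" where
  "ascent n W i = {k. i \<le> k \<and> k < n \<and> (\<forall>l \<in> {i..k}. (l, Suc l) \<in> arrows W)}"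

definition descent :: "diagram \<Rightarrow> nat \<Rightarrow> nat set" where
  "descent W i = {k. k < i \<and> (\<forall>l \<in> {k..<i}. (Suc l, l) \<in> arrows W)}"

lemma ascent_subset: "ascent n W i \<subseteq> {..<n}"
  by (auto simp: ascent_def)

lemma descent_subset: "descent W i \<subseteq> {..<i}"
  by (auto simp: descent_def)

lemma card_ascent_rec:
  assumes "k < n" "(k, Suc k) \<in> arrows W"
  shows "card (ascent n W k) = Suc (card (ascent n W (Suc k)))"
proof -
  have "ascent n W k = insert k (ascent n W (Suc k))"
  proof (intro equalityI subsetI)
    fix l assume l: "l \<in> ascent n W k"
    show "l \<in> insert k (ascent n W (Suc k))"
      using l by (cases "l = k") (auto simp: ascent_def)
  next
    fix l assume "l \<in> insert k (ascent n W (Suc k))"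
    then show "l \<in> ascent n W k"
    proof
      assume l: "l \<in> ascent n W (Suc k)"
      then have "{k..l} = insert k {Suc k..l}" by (auto simp: ascent_def)
      with l assms show ?thesis by (auto simp: ascent_def)
    qed (use assms in \<open>auto simp: ascent_def\<close>)
  qed
  moreover have "k \<notin> ascent n W (Suc k)" by (simp add: ascent_def)
  moreover have "finite (ascent n W (Suc k))"
    by (rule finite_subset[OF ascent_subset]) simp
  ultimately show ?thesis by simp
qed

lemma card_descent_rec:
  assumes "(Suc k, k) \<in> arrows W"
  shows "card (descent W (Suc k)) = Suc (card (descent W k))"
proof -
  have "descent W (Suc k) = insert k (descent W k)"
  proof (intro equalityI subsetI)
    fix l assume l: "l \<in> descent W (Suc k)"
    show "l \<in> insert k (descent W k)"
      using l by (cases "l = k") (auto simp: descent_def)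
  next
    fix l assume "l \<in> insert k (descent W k)"
    then show "l \<in> descent W (Suc k)"
    proof
      assume l: "l \<in> descent W k"
      then have "{l..<Suc k} = insert k {l..<k}" by (auto simp: descent_def)
      with l assms show ?thesis by (auto simp: descent_def)
    qed (use assms in \<open>auto simp: descent_def\<close>)
  qed
  moreover have "k \<notin> descent W k" by (simp add: descent_def)
  moreover have "finite (descent W k)"
    by (rule finite_subset[OF descent_subset]) simp
  ultimately show ?thesis by simp
qed

text \<open>Following an arrow costs 3 (call, arrow bit, vertex bit); a last call that finds no
  arrow costs at most 2.\<close>

lemma time_scan_up_tm: "time (scan_up_tm n W B i) \<le> 3 * card (ascent n W i) + 2"
proof (induction n W B i rule: scan_up_tm.induct)
  case (1 n W B k)
  then show ?case
    using card_ascent_rec[of k n W] by (auto simp: scan_up_tm.simps[of n W B k])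
qed

lemma time_scan_down_tm: "time (scan_down_tm W B i) \<le> 3 * card (descent W i) + 2"
proof (induction W B i rule: scan_down_tm.induct)
  case (2 W B k)
  then show ?case using card_descent_rec[of k W] by auto
qed simp

lemma time_targets_tm:
  "time (targets_tm n W B i) \<le> 3 * card (ascent n W i) + 3 * card (descent W i) + 6"
  using time_scan_up_tm[of n W B i] time_scan_down_tm[of W B i] by (simp add: targets_tm_def)

lemma time_targets_tm_le:
  assumes "i \<in> {1..n}"
  shows "time (targets_tm n W B i) \<le> 6 * n + 6"
proof -
  have "card (ascent n W i) \<le> n" using card_mono[OF _ ascent_subset] by (metis card_lessThan finite_lessThan)
  moreover have "card (descent W i) \<le> i"
    using card_mono[OF _ descent_subset] by (metis card_lessThan finite_lessThan)
  ultimately show ?thesis using time_targets_tm[of n W B i] assms by simp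
qed

lemma scan_up_tm_length:
  "length (val (scan_up_tm n W B i)) \<le> (if (i, Suc i) \<in> arrows W then 1 else 0)"
proof (induction n W B i rule: scan_up_tm.induct)
  case (1 n W B k)
  have "length (val (scan_up_tm n W B (Suc k))) \<le> 1"
    if "\<not> n \<le> k" "(k, Suc k) \<in> arrows W" "Suc k \<in> vertices B"
    by (rule order_trans[OF 1]) (use that in auto)
  then show ?case by (auto simp: scan_up_tm.simps[of n W B k])
qed

lemma scan_down_tm_length:
  "length (val (scan_down_tm W B i)) \<le> (if (i, i - 1) \<in> arrows W \<and> 0 < i then 1 else 0)"
proof (induction W B i rule: scan_down_tm.induct)
  case (2 W B k)
  have "length (val (scan_down_tm W B k)) \<le> 1" if "(Suc k, k) \<in> arrows W" "k \<in> vertices B"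
    by (rule order_trans[OF 2]) (use that in auto)
  then show ?case by auto
qed simp

lemma targets_tm_length: "length (val (targets_tm n W B i)) \<le> 2"
  using scan_up_tm_length[of n W B i] scan_down_tm_length[of W B i]
  by (auto simp: targets_tm_def split: if_splits)

section \<open>Shared budget of the scans from sources\<close>

definition sources :: "diagram \<Rightarrow> nat set" where
  "sources W = {i. 0 < i \<and> (i, Suc i) \<in> arrows W \<and> (i, i - 1) \<in> arrows W}"

text \<open>Each scan returns at most one vertex, and none without an arrow leaving \<open>i\<close>
  in its direction; so two results require both arrows.\<close>

lemma targets_tm_source:
  "2 \<le> length (val (targets_tm n W B i)) \<Longrightarrow> i \<in> sources W"
  using scan_up_tm_length[of n W B i] scan_down_tm_length[of W B i]
  by (auto simp: targets_tm_def sources_def split: if_splits)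

text \<open>A directed path cannot run through a second source, so the paths scanned from two sources
  have no arrow in common.\<close>

lemma sum_card_ascent:
  assumes w: "boolean n w" and T: "finite T" "T \<subseteq> sources (boolean_diagram n w)"
  shows "(\<Sum>i \<in> T. card (ascent n (boolean_diagram n w) i)) \<le> n"
proof -
  let ?W = "boolean_diagram n w"
  have d: "ascent n ?W i \<inter> ascent n ?W j = {}" if "i \<in> T" "j \<in> T" "i < j" for i j
  proof (rule ccontr)
    assume "\<not> ?thesis"
    then obtain k where k: "k \<in> ascent n ?W i" "k \<in> ascent n ?W j" by blast
    then have "j - 1 \<in> {i..k}" using that by (auto simp: ascent_def)
    then have "(j - 1, Suc (j - 1)) \<in> arrows ?W" using k(1) unfolding ascent_def by blast
    moreover have "(j, j - 1) \<in> arrows ?W" "Suc (j - 1) = j" using that T(2) by (auto simp: sources_def)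
    ultimately show False using arrows_asym[OF w] by metis
  qed
  have "(\<Sum>i \<in> T. card (ascent n ?W i)) = card (\<Union>i \<in> T. ascent n ?W i)"
    using T(1) finite_subset[OF ascent_subset] d
    by (intro card_UN_disjoint[symmetric]) (auto, metis disjoint_iff linorder_neqE_nat)
  also have "\<dots> \<le> card {..<n}" by (intro card_mono) (auto dest: subsetD[OF ascent_subset])
  finally show ?thesis by simp
qed

lemma sum_card_descent:
  assumes w: "boolean n w" and T: "finite T" "T \<subseteq> sources (boolean_diagram n w)" "T \<subseteq> {1..n}"
  shows "(\<Sum>i \<in> T. card (descent (boolean_diagram n w) i)) \<le> n"
proof -
  let ?W = "boolean_diagram n w"
  have d: "descent ?W i \<inter> descent ?W j = {}" if "i \<in> T" "j \<in> T" "i < j" for i j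
  proof (rule ccontr)
    assume "\<not> ?thesis"
    then obtain k where k: "k \<in> descent ?W i" "k \<in> descent ?W j" by blast
    then have "i \<in> {k..<j}" using that by (auto simp: descent_def)
    then have "(Suc i, i) \<in> arrows ?W" using k(2) unfolding descent_def by blast
    moreover have "(i, Suc i) \<in> arrows ?W" using that T(2) by (auto simp: sources_def)
    ultimately show False using arrows_asym[OF w] by metis
  qed
  have "(\<Sum>i \<in> T. card (descent ?W i)) = card (\<Union>i \<in> T. descent ?W i)"
    using T(1) finite_subset[OF descent_subset] d
    by (intro card_UN_disjoint[symmetric]) (auto, metis disjoint_iff linorder_neqE_nat)
  also have "\<dots> \<le> card {..<n}" using T(3) by (intro card_mono) (force dest: subsetD[OF descent_subset])+
  finally show ?thesis by simp
qed

text \<open>The bound of \<open>time_targets_tm\<close> plus 1 for the call of the traversal. An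
  index that is no source is never kept and gets no budget.\<close>

definition keep_cost :: "nat \<Rightarrow> diagram \<Rightarrow> nat \<Rightarrow> nat" where
  "keep_cost n W i =
     (if i \<in> sources W then 3 * card (ascent n W i) + 3 * card (descent W i) + 7 else 0)"

lemma sum_keep_cost:
  assumes "boolean n w" "set L \<subseteq> {1..n}" "distinct L"
  shows "(\<Sum>i\<leftarrow>L. keep_cost n (boolean_diagram n w) i) \<le> 13 * n"
proof -
  let ?W = "boolean_diagram n w"
  let ?T = "set L \<inter> sources ?W"
  have "(\<Sum>i\<leftarrow>L. keep_cost n ?W i) = (\<Sum>i\<in>set L. keep_cost n ?W i)"
    using assms(3) by (simp add: sum_list_distinct_conv_sum_set)
  also have "\<dots> = (\<Sum>i\<in>?T. 3 * card (ascent n ?W i) + 3 * card (descent ?W i) + 7)"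
    unfolding keep_cost_def by (subst sum.inter_restrict) auto
  also have "\<dots> = 3 * (\<Sum>i\<in>?T. card (ascent n ?W i)) + 3 * (\<Sum>i\<in>?T. card (descent ?W i)) + 7 * card ?T"
    by (simp add: sum.distrib sum_distrib_left)
  \<comment> \<open>Upward and downward scans sum to at most \<open>n\<close> each, and there are at
    most \<open>n\<close> sources in the list.\<close>
  also have "\<dots> \<le> 3 * n + 3 * n + 7 * n"
  proof -
    have "card ?T \<le> card {1..n}" using assms(2) by (intro card_mono) auto
    then show ?thesis
      using sum_card_ascent[OF assms(1), of ?T] sum_card_descent[OF assms(1), of ?T] assms(2)
      by (intro add_mono mult_le_mono) auto
  qed
  finally show ?thesis by simp
qed

text \<open>Two copies give \<open>6 * n\<close>; the call, the new vertex and two links of cost at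
  most 4 give 10.\<close>

lemma time_perform_tm: "time (perform_tm n W B i j P) \<le> 6 * n + 10"
proof -
  have link: "time (link_tm W j k C) \<le> 4" for k C by (simp add: link_tm_def)
  show ?thesis
    using add_mono[OF link link] by (simp add: perform_tm_def)
qed

lemma snd_perform_tm: "length (snd (val (perform_tm n W B i j P))) = Suc (length P)"
  by (simp add: perform_tm_def)

text \<open>A failed pass counts as leaving nothing, so that it may be charged for its whole
  list.\<close>

fun left_over :: "(diagram \<times> step list \<times> nat list) option \<Rightarrow> nat" where
  "left_over None = 0"
| "left_over (Some (B, P, L)) = length L"

text \<open>A forced insertion costs \<open>O(n)\<close> but shortens the list; all elements that stay cost
  \<open>O(n)\<close> together.\<close>

lemma time_forced_pass_tm:
  assumes "set L \<subseteq> {1..n}"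
  shows "left_over (val (forced_pass_tm n W B P L)) \<le> length L \<and>
    time (forced_pass_tm n W B P L) \<le> 1 + (\<Sum>i\<leftarrow>L. keep_cost n W i) +
      (12 * n + 17) * (length L - left_over (val (forced_pass_tm n W B P L)))"
  using assms
proof (induction L arbitrary: B P)
  case (Cons i L)
  let ?js = "val (targets_tm n W B i)"
  have t: "time (targets_tm n W B i) \<le> 6 * n + 6" using Cons.prems by (intro time_targets_tm_le) auto
  consider "?js = []" | j where "?js = [j]" | j k ls where "?js = j # k # ls"
    by (metis neq_Nil_conv)
  then show ?case
  proof cases
    case 1
    then show ?thesis using t by simp
  next
    case (2 j)
    let ?BP = "val (perform_tm n W B i j P)"
    let ?r = "forced_pass_tm n W (fst ?BP) (snd ?BP) L"
    have r: "forced_pass_tm n W B P (i # L) =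
        TM (val ?r) (1 + time (targets_tm n W B i) + time (perform_tm n W B i j P) + time ?r)"
      using 2 by (intro tm.expand) simp
    have IH: "left_over (val ?r) \<le> length L" "time ?r \<le> 1 + (\<Sum>i\<leftarrow>L. keep_cost n W i) +
      (12 * n + 17) * (length L - left_over (val ?r))" using Cons by auto
    \<comment> \<open>The subtraction is not truncated, so the budget grows by
      \<open>12 * n + 17\<close>: 1 for the call, \<open>6 * n + 6\<close> for the targets and
      \<open>6 * n + 10\<close> for the insertion.\<close>
    have "Suc (length L) - left_over (val ?r) = Suc (length L - left_over (val ?r))"
      using IH(1) by simp
    then show ?thesis
      using IH t time_perform_tm[of n W B i j P] unfolding r by simp
  next
    case (3 j k ls)
    let ?r = "forced_pass_tm n W B P L"
    have "i \<in> sources W" using 3 targets_tm_source[of n W B i] by simp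
    then have "1 + time (targets_tm n W B i) \<le> keep_cost n W i"
      using time_targets_tm[of n W B i] by (simp add: keep_cost_def)
    moreover have "left_over (val ?r) \<le> length L" "time ?r \<le> 1 + (\<Sum>i\<leftarrow>L. keep_cost n W i) +
      (12 * n + 17) * (length L - left_over (val ?r))" using Cons by auto
    ultimately show ?thesis using 3 by (cases "val ?r") auto
  qed
qed simp

text \<open>Each forced insertion moves one index from the list into the record. The invariant sum
  will bound the final reversal of \<open>P\<close>.\<close>

lemma forced_pass_tm_result:
  assumes "val (forced_pass_tm n W B P L) = Some (B', P', L')"
  shows "set L' \<subseteq> set L \<and> (distinct L \<longrightarrow> distinct L') \<and> length P' + length L' = length P + length L"
  using assms
proof (induction L arbitrary: B P B' P' L')
  case (Cons i L)
  consider "val (targets_tm n W B i) = []" | j where "val (targets_tm n W B i) = [j]"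
    | j k ls where "val (targets_tm n W B i) = j # k # ls"
    by (metis neq_Nil_conv)
  then show ?case
  proof cases
    case 1
    then show ?thesis using Cons.prems by simp
  next
    case (2 j)
    with Cons.prems have "val (forced_pass_tm n W (fst (val (perform_tm n W B i j P)))
        (snd (val (perform_tm n W B i j P))) L) = Some (B', P', L')" by simp
    from Cons.IH[OF this] show ?thesis by (auto simp: snd_perform_tm)
  next
    case (3 j k ls)
    with Cons.prems obtain L'' where
      "val (forced_pass_tm n W B P L) = Some (B', P', L'')" "L' = i # L''"
      by (auto split: option.splits)
    with Cons.IH[OF this(1)] show ?thesis by auto
  qed
qed simp

text \<open>A pass that shortens the list by d costs at most \<open>15 * n + 4\<close> (call, kept
  indices, two length computations) plus d times \<open>12 * n + 17\<close>. As d is positive except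
  possibly in the last pass, the sum \<open>27 * n + 21\<close> per index, and once more for the
  last pass, suffices.\<close>

lemma time_forced_passes_tm:
  assumes w: "boolean n w" and "set L \<subseteq> {1..n}" "distinct L"
  shows "time (forced_passes_tm n (boolean_diagram n w) B P L) \<le> (length L + 1) * (27 * n + 21)"
  using assms(2,3)
proof (induction "length L" arbitrary: B P L rule: less_induct)
  case less
  let ?W = "boolean_diagram n w"
  let ?r = "forced_pass_tm n ?W B P L"
  have "length L \<le> card {1..n}"
    using less.prems by (metis card_mono distinct_card finite_atLeastAtMost)
  then have len: "length L \<le> n" by simp
  have t: "left_over (val ?r) \<le> length L"
    "time ?r \<le> 1 + 13 * n + (12 * n + 17) * (length L - left_over (val ?r))"
    using time_forced_pass_tm[OF less.prems(1), of ?W B P] sum_keep_cost[OF w less.prems] by auto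
  show ?case
  proof (cases "val ?r")
    case None
    then have "time (forced_passes_tm n ?W B P L) = 1 + time ?r"
      by (subst forced_passes_tm.simps) simp
    also have "\<dots> \<le> 1 + (1 + 13 * n + (12 * n + 17) * length L)" using t(2) None by simp
    also have "\<dots> \<le> (length L + 1) * (27 * n + 21)" by (simp add: algebra_simps)
    finally show ?thesis .
  next
    case (Some a)
    obtain B' P' L' where a: "a = (B', P', L')" by (cases a)
    note L' = forced_pass_tm_result[OF Some[unfolded a]]
    have t': "length L' \<le> length L"
      "time ?r \<le> 1 + 13 * n + (12 * n + 17) * (length L - length L')"
      using t by (auto simp: Some a)
    show ?thesis
    proof (cases "length L' < length L")
      case True
      then obtain d where d: "length L = length L' + Suc d" by (metis less_natE add_Suc_right)
      have "time (forced_passes_tm n ?W B P L) =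
          1 + time ?r + (length L' + 1) + (length L + 1) + time (forced_passes_tm n ?W B' P' L')"
        using True by (subst forced_passes_tm.simps) (simp add: Some a)
      also have "time (forced_passes_tm n ?W B' P' L') \<le> (length L' + 1) * (27 * n + 21)"
        using less.hyps[of L' B' P'] True L' less.prems by auto
      also have "1 + time ?r + (length L' + 1) + (length L + 1) + (length L' + 1) * (27 * n + 21) \<le>
          (length L + 1) * (27 * n + 21)"
        using t' len by (simp add: d algebra_simps)
      finally show ?thesis by simp
    next
      case False
      then have "time (forced_passes_tm n ?W B P L) = 1 + time ?r + (length L' + 1) + (length L + 1)"
        by (subst forced_passes_tm.simps) (simp add: Some a)
      also have "\<dots> \<le> 1 * (27 * n + 21)" using t' False len by simp
      also have "\<dots> \<le> (length L + 1) * (27 * n + 21)" by (intro mult_le_mono) auto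
      finally show ?thesis .
    qed
  qed
qed

lemma forced_passes_tm_result:
  assumes "val (forced_passes_tm n W B P L) = Some (B', P', L')"
  shows "set L' \<subseteq> set L \<and> (distinct L \<longrightarrow> distinct L') \<and> length P' + length L' = length P + length L"
  using assms
proof (induction "length L" arbitrary: B P L rule: less_induct)
  case less
  obtain B1 P1 L1 where r: "val (forced_pass_tm n W B P L) = Some (B1, P1, L1)"
    using less.prems by (subst (asm) forced_passes_tm.simps) (auto split: option.splits)
  show ?case
  proof (cases "length L1 < length L")
    case True
    have "val (forced_passes_tm n W B P L) = val (forced_passes_tm n W B1 P1 L1)"
      using r True by (subst forced_passes_tm.simps) simp
    then have "val (forced_passes_tm n W B1 P1 L1) = Some (B', P', L')" using less.prems by simp
    from less.hyps[OF True this] forced_pass_tm_result[OF r] show ?thesis by auto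
  next
    case False
    have "val (forced_passes_tm n W B P L) = Some (B1, P1, L1)"
      using r False by (subst forced_passes_tm.simps) simp
    then show ?thesis using less.prems forced_pass_tm_result[OF r] by simp
  qed
qed

text \<open>To \<open>12 * n + 17\<close> for call, targets and insertion come at most 3 for the
  membership test in a list of at most two targets, and 1 because the list to be reversed
  grows.\<close>

lemma time_matched_insertions_tm:
  assumes "set I \<subseteq> {1..n}"
  shows "time (matched_insertions_tm n W B P I J) \<le> (length I + 1) * (12 * n + 21) + length P"
  using assms
proof (induction I arbitrary: B P J)
  case Nil
  then show ?case by (cases J) auto
next
  case (Cons i I)
  have t: "time (targets_tm n W B i) \<le> 6 * n + 6" using Cons.prems by (intro time_targets_tm_le) auto
  have l: "length (val (targets_tm n W B i)) \<le> 2" by (rule targets_tm_length)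
  show ?case
  proof (cases J)
    case J: (Cons j K)
    let ?BP = "val (perform_tm n W B i j P)"
    have "time (matched_insertions_tm n W (fst ?BP) (snd ?BP) I K) \<le>
        (length I + 1) * (12 * n + 21) + Suc (length P)"
      using Cons.IH[of "fst ?BP" "snd ?BP" K] Cons.prems unfolding snd_perform_tm by simp
    then show ?thesis
      using t l time_perform_tm[of n W B i j P] by (simp add: J)
  qed simp
qed

section \<open>The quadratic bound\<close>

lemma time_subdiagram_tm: "time (subdiagram_tm n B C) \<le> 7 * n + 1"
  by (induction n B C rule: subdiagram_tm.induct) auto

lemma time_vertex_list_tm: "time (vertex_list_tm n V acc) = 2 * n + 1"
  by (induction n V acc rule: vertex_list_tm.induct) auto

lemma time_missing_list_tm: "time (missing_list_tm n W B acc) = 3 * n + 1"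
  by (induction n W B acc rule: missing_list_tm.induct) auto

lemma time_insertion_algorithm_tm:
  assumes w: "boolean n w" and n: "1 \<le> n"
  shows "time (insertion_algorithm_tm n (boolean_diagram n u) (boolean_diagram n v) (boolean_diagram n w))
    \<le> 200 * n ^ 2"
proof -
  let ?U = "boolean_diagram n u" and ?V = "boolean_diagram n v" and ?W = "boolean_diagram n w"
  define S where "S = sorted_list_of_set (supp n v)"
  have S: "val (vertex_list_tm n ?V []) = S"
    using filter_upt_eq[OF supp_subset] by (simp add: val_vertex_list_tm S_def)
  have dS: "distinct S" "set S \<subseteq> {1..n}" using supp_subset by (auto simp: S_def)
  then have "length S \<le> card {1..n}"
    by (metis card_mono distinct_card finite_atLeastAtMost)
  then have lS: "length S \<le> n" by simp
  let ?r = "forced_passes_tm n ?W ?U [] S"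
  define rest where "rest = (case val ?r of None \<Rightarrow> 0
    | Some (B', P, S') \<Rightarrow> time (missing_list_tm n ?W B' []) +
        time (matched_insertions_tm n ?W B' P S' (val (missing_list_tm n ?W B' []))))"
  have "time ?r \<le> (length S + 1) * (27 * n + 21)"
    using time_forced_passes_tm[OF w dS(2,1)] .
  also have "\<dots> \<le> (n + 1) * (27 * n + 21)" using lS by (intro mult_le_mono) auto
  finally have r: "time ?r \<le> (n + 1) * (27 * n + 21)" .
  have "rest \<le> 3 * n + 1 + (n + 1) * (12 * n + 21) + n"
  proof (cases "val ?r")
    case None
    then show ?thesis by (simp add: rest_def)
  next
    case (Some a)
    obtain B' P S' where a: "a = (B', P, S')" by (cases a)
    note S' = forced_passes_tm_result[OF Some[unfolded a]]
    let ?J = "val (missing_list_tm n ?W B' [])"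
    have "time (matched_insertions_tm n ?W B' P S' ?J) \<le> (length S' + 1) * (12 * n + 21) + length P"
      using S' dS by (intro time_matched_insertions_tm) auto
    also have "\<dots> \<le> (n + 1) * (12 * n + 21) + n"
      using S' lS by (intro add_mono mult_le_mono) auto
    finally show ?thesis by (simp add: rest_def Some a time_missing_list_tm)
  qed
  moreover have "time (insertion_algorithm_tm n ?U ?V ?W) \<le>
      1 + 3 * n + (2 * n + 1) + (7 * n + 1) + time ?r + rest"
    using time_subdiagram_tm[of n ?U ?W]
    by (auto simp: insertion_algorithm_tm_def S time_vertex_list_tm rest_def split: option.splits)
  ultimately have "time (insertion_algorithm_tm n ?U ?V ?W) \<le>
      1 + 3 * n + (2 * n + 1) + (7 * n + 1) + (n + 1) * (27 * n + 21) +
      (3 * n + 1 + (n + 1) * (12 * n + 21) + n)"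
    using r by linarith
  also have "\<dots> = 39 * n ^ 2 + 97 * n + 46" by (simp add: algebra_simps power2_eq_square)
  \<comment> \<open>The coefficients sum to 182, which is rounded up to 200.\<close>
  also have "\<dots> \<le> 39 * n ^ 2 + 97 * n ^ 2 + 46 * n ^ 2"
    using n by (intro add_mono) (auto simp: power2_eq_square)
  finally show ?thesis by simp
qed

lemma finite_boolean: "finite {w. boolean n w}"
  by (rule finite_subset[of _ "{w. w permutes {1..Suc n}}"])
    (auto simp: boolean_def weyl_A_def intro: finite_permutations)

lemma worst_case_time_le:
  assumes "1 \<le> n"
  shows "worst_case_time n \<le> 200 * n ^ 2"
proof -
  let ?t = "\<lambda>u v w. time (insertion_algorithm_tm n
    (boolean_diagram n u) (boolean_diagram n v) (boolean_diagram n w))"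
  let ?T = "{?t u v w | u v w. boolean n u \<and> boolean n v \<and> boolean n w}"
  let ?b = "{w. boolean n w}"
  \<comment> \<open>\<open>Max\<close> is meaningful only on a finite non-empty set: there are
    finitely many triples, and the identity provides one.\<close>
  have "?T = (\<lambda>(u, v, w). ?t u v w) ` (?b \<times> ?b \<times> ?b)" by force
  then have "finite ?T" using finite_boolean by simp
  moreover have "boolean n id" unfolding boolean_iff by (rule exI[of _ "[]"]) simp
  then have "?T \<noteq> {}" by blast
  ultimately show ?thesis
    unfolding worst_case_time_def using time_insertion_algorithm_tm[OF _ assms] by auto
qed

theorem theorem4p2:
  shows "(\<forall>n u v w. n \<ge> 1 \<and> boolean n u \<and> boolean n v \<and> boolean n w \<longrightarrow>
           (case insertion_algorithm n
                   (boolean_diagram n u) (boolean_diagram n v) (boolean_diagram n w) of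
              Some P \<Rightarrow> (\<exists>us bs. boolean_insertion_path n u v w us bs \<and> P = path_steps n us bs)
            | None \<Rightarrow> \<not> (\<exists>us bs. boolean_insertion_path n u v w us bs)))
       \<and> (\<forall>n u v w. n \<ge> 1 \<and> boolean n u \<and> boolean n v \<and> boolean n w \<longrightarrow>
           val (insertion_algorithm_tm n
                  (boolean_diagram n u) (boolean_diagram n v) (boolean_diagram n w)) =
           insertion_algorithm n
             (boolean_diagram n u) (boolean_diagram n v) (boolean_diagram n w))
       \<and> (\<lambda>n. real (worst_case_time n)) \<in> O(\<lambda>n. (real n)\<^sup>2)"
proof (intro conjI allI impI)
  show "(\<lambda>n. real (worst_case_time n)) \<in> O(\<lambda>n. (real n)\<^sup>2)"
  proof (rule bigoI[of _ 200], rule eventually_sequentiallyI[of 1])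
    fix n :: nat assume "1 \<le> n"
    then have "real (worst_case_time n) \<le> real (200 * n ^ 2)"
      using worst_case_time_le of_nat_le_iff by blast
    then show "norm (real (worst_case_time n)) \<le> 200 * norm ((real n)\<^sup>2)" by simp
  qed
qed (use insertion_algorithm_correct insertion_algorithm_tm_val in blast)+

end
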